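(* Let $X$ be a complex quasi-projective variety with a fixed real form $Y_0$ and identification $X=Y_0\times_{\operatorname{Spec}\mathbb{R}}\operatorname{Spec}\mathbb{C}$, so that $G=\operatorname{Gal}(\mathbb{C}/\mathbb{R})$ acts on $\operatorname{Aut}(X/\mathbb{C})$. Suppose $\operatorname{Aut}(X/\mathbb{C})$ is finite and let $H\subset\operatorname{Aut}(X/\mathbb{C})$ be a Sylow $2$-subgroup preserved by $G$. Then $$\sum_{[Y]\in\mathrm{H}^1(G,H)}\frac{1}{\#(\operatorname{Aut}(Y/\mathbb{R})\cap H)}=\frac{\# Z^1(G,H)}{\# H}\leq 1,$$ where for a class in $\mathrm{H}^1(G,H)$ represented by $f\in Z^1(G,H)$, $Y$ denotes the real form $X/\langle f\circ\sigma_0\rangle$. Moreover, if $H$ is not abelian, then the inequality is strict.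
   Context: Let $G=\operatorname{Gal}(\mathbb{C}/\mathbb{R})=\{\mathrm{id},c\}$ with $c$ complex conjugation. A real form of a complex quasi-projective variety $X$ is a scheme $Y$ over $\operatorname{Spec}\mathbb{R}$ with $X\cong Y\times_{\operatorname{Spec}\mathbb{R}}\operatorname{Spec}\mathbb{C}$ over $\operatorname{Spec}\mathbb{C}$. Given the fixed real form $Y_0$, put $\sigma_0=\mathrm{id}_{Y_0}\times c\colon X\to X$; $G$ acts on $\operatorname{Aut}(X/\mathbb{C})$ (automorphisms over $\operatorname{Spec}\mathbb{C}$) by $c\cdot f=\sigma_0\circ f\circ\sigma_0$. For a $G$-stable subgroup $H$ of $\operatorname{Aut}(X/\mathbb{C})$, $Z^1(G,H)=\{f\in H: f\circ(c\cdot f)=\mathrm{id}_X\}$, and $\mathrm{H}^1(G,H)$ is the quotient of $Z^1(G,H)$ by the equivalence relation $f\sim f'$ iff $f'=h^{-1}\circ f\circ(c\cdot h)$ for some $h\in H$. For $f\in Z^1(G,H)$, $\sigma=f\circ\sigma_0$ is an anti-holomorphic involution of $X$ (a real structure), and the quotient $Y=X/\langle\sigma\rangle$ is a real form of $X$ by Galois descent. The group $\operatorname{Aut}(Y/\mathbb{R})$ of automorphisms of $Y$ over $\operatorname{Spec}\mathbb{R}$ is identified with the centralizer $\{h\in\operatorname{Aut}(X/\mathbb{C}): h\circ\sigma=\sigma\circ h\}$, so $\operatorname{Aut}(Y/\mathbb{R})\cap H=\{h\in H: h\circ f\circ\sigma_0=f\circ\sigma_0\circ h\}$; its cardinality depends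 only on the class of $f$ in $\mathrm{H}^1(G,H)$. *)

theory Defs
  imports
    "HOL-Algebra.RingHom"
    "HOL-Computational_Algebra.Primes"
    "HOL-Analysis.Abstract_Topology"
    "HOL-Library.Poly_Mapping"
begin

section \<open>Locally ringed spaces\<close>

text \<open>Only the values \<open>sections X U\<close> and \<open>restr X U V\<close> for open sets \<open>V \<subseteq> U\<close> matter.\<close>

record ('p, 's) rspace =
  rtop :: "'p topology"
  sections :: "'p set \<Rightarrow> 's ring"
  restr :: "'p set \<Rightarrow> 'p set \<Rightarrow> 's \<Rightarrow> 's"

text \<open>In the sheaf axioms, the empty cover of the empty set is allowed; it forces the ring of
  sections over the empty set to be the zero ring.\<close>

locale ringed_space =
  fixes X :: "('p, 's) rspace"
  assumes sections_cring: "openin (rtop X) U \<Longrightarrow> cring (sections X U)"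
    and restr_hom: "\<lbrakk>openin (rtop X) U; openin (rtop X) V; V \<subseteq> U\<rbrakk>
          \<Longrightarrow> restr X U V \<in> ring_hom (sections X U) (sections X V)"
    and restr_id: "\<lbrakk>openin (rtop X) U; s \<in> carrier (sections X U)\<rbrakk> \<Longrightarrow> restr X U U s = s"
    and restr_restr: "\<lbrakk>openin (rtop X) U; openin (rtop X) V; openin (rtop X) W; W \<subseteq> V; V \<subseteq> U;
          s \<in> carrier (sections X U)\<rbrakk> \<Longrightarrow> restr X V W (restr X U V s) = restr X U W s"
    and sheaf_locality: "\<lbrakk>\<forall>V\<in>\<V>. openin (rtop X) V;
          s \<in> carrier (sections X (\<Union>\<V>)); t \<in> carrier (sections X (\<Union>\<V>));
          \<forall>V\<in>\<V>. restr X (\<Union>\<V>) V s = restr X (\<Union>\<V>) V t\<rbrakk> \<Longrightarrow> s = t"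
    and sheaf_gluing: "\<lbrakk>\<forall>V\<in>\<V>. openin (rtop X) V; \<forall>V\<in>\<V>. \<sigma> V \<in> carrier (sections X V);
          \<forall>V\<in>\<V>. \<forall>W\<in>\<V>. restr X V (V \<inter> W) (\<sigma> V) = restr X W (V \<inter> W) (\<sigma> W)\<rbrakk>
          \<Longrightarrow> \<exists>s\<in>carrier (sections X (\<Union>\<V>)). \<forall>V\<in>\<V>. restr X (\<Union>\<V>) V s = \<sigma> V"

definition germ :: "('p, 's) rspace \<Rightarrow> 'p \<Rightarrow> 'p set \<Rightarrow> 's \<Rightarrow> ('p set \<times> 's) set" where
  "germ X x U s = {(V, t). openin (rtop X) V \<and> x \<in> V \<and> t \<in> carrier (sections X V) \<and>
     (\<exists>W. openin (rtop X) W \<and> x \<in> W \<and> W \<subseteq> U \<inter> V \<and> restr X U W s = restr X V W t)}"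

text \<open>The ring operations on equivalence classes are written as unions over all representatives;
  all the sets in such a union coincide. The same device is used for localizations below.\<close>

definition stalk :: "('p, 's) rspace \<Rightarrow> 'p \<Rightarrow> ('p set \<times> 's) set ring" where
  "stalk X x = \<lparr>
     carrier = {germ X x U s | U s. openin (rtop X) U \<and> x \<in> U \<and> s \<in> carrier (sections X U)},
     monoid.mult = (\<lambda>a b. \<Union>(U, s)\<in>a. \<Union>(V, t)\<in>b. germ X x (U \<inter> V)
       (restr X U (U \<inter> V) s \<otimes>\<^bsub>sections X (U \<inter> V)\<^esub> restr X V (U \<inter> V) t)),
     one = germ X x (topspace (rtop X)) \<one>\<^bsub>sections X (topspace (rtop X))\<^esub>,
     zero = germ X x (topspace (rtop X)) \<zero>\<^bsub>sections X (topspace (rtop X))\<^esub>,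
     add = (\<lambda>a b. \<Union>(U, s)\<in>a. \<Union>(V, t)\<in>b. germ X x (U \<inter> V)
       (restr X U (U \<inter> V) s \<oplus>\<^bsub>sections X (U \<inter> V)\<^esub> restr X V (U \<inter> V) t))\<rparr>"

definition local_ring :: "'a ring \<Rightarrow> bool" where
  "local_ring R \<longleftrightarrow> cring R \<and> (\<exists>!\<mm>. maximalideal \<mm> R)"

definition locally_ringed_space :: "('p, 's) rspace \<Rightarrow> bool" where
  "locally_ringed_space X \<longleftrightarrow> ringed_space X \<and> (\<forall>x\<in>topspace (rtop X). local_ring (stalk X x))"

definition open_subspace :: "('p, 's) rspace \<Rightarrow> 'p set \<Rightarrow> ('p, 's) rspace" where
  "open_subspace X U = X\<lparr>rtop := subtopology (rtop X) U\<rparr>"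


section \<open>Morphisms\<close>

text \<open>A morphism \<open>\<phi> : X \<rightarrow> Y\<close> carries its source and target. The ring homomorphism
  \<open>smap \<phi> V\<close> goes from the sections of \<open>Y\<close> over \<open>V\<close> to the sections of \<open>X\<close> over the preimage
  of \<open>V\<close>. All functions involved are extensional, so that equality of morphisms is
  equality of records.\<close>

record ('p, 's, 'q, 't) rs_map =
  src :: "('p, 's) rspace"
  tgt :: "('q, 't) rspace"
  pmap :: "'p \<Rightarrow> 'q"
  smap :: "'q set \<Rightarrow> 't \<Rightarrow> 's"

definition pre :: "('p, 's, 'q, 't) rs_map \<Rightarrow> 'q set \<Rightarrow> 'p set" where
  "pre \<phi> V = {x \<in> topspace (rtop (src \<phi>)). pmap \<phi> x \<in> V}"

definition stalk_map ::
    "('p, 's, 'q, 't) rs_map \<Rightarrow> 'p \<Rightarrow> ('q set \<times> 't) set \<Rightarrow> ('p set \<times> 's) set" where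
  "stalk_map \<phi> x a = (\<Union>(V, s)\<in>a. germ (src \<phi>) x (pre \<phi> V) (smap \<phi> V s))"

definition mor ::
    "('p, 's) rspace \<Rightarrow> ('q, 't) rspace \<Rightarrow> ('p, 's, 'q, 't) rs_map \<Rightarrow> bool" where
  "mor X Y \<phi> \<longleftrightarrow>
     src \<phi> = X \<and> tgt \<phi> = Y \<and>
     pmap \<phi> \<in> extensional (topspace (rtop X)) \<and>
     continuous_map (rtop X) (rtop Y) (pmap \<phi>) \<and>
     smap \<phi> \<in> extensional {V. openin (rtop Y) V} \<and>
     (\<forall>V. openin (rtop Y) V \<longrightarrow>
        smap \<phi> V \<in> extensional (carrier (sections Y V)) \<and>
        smap \<phi> V \<in> ring_hom (sections Y V) (sections X (pre \<phi> V))) \<and>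
     (\<forall>V W. openin (rtop Y) V \<longrightarrow> openin (rtop Y) W \<longrightarrow> W \<subseteq> V \<longrightarrow>
        (\<forall>s\<in>carrier (sections Y V).
           smap \<phi> W (restr Y V W s) = restr X (pre \<phi> V) (pre \<phi> W) (smap \<phi> V s))) \<and>
     (\<forall>x\<in>topspace (rtop X). \<forall>\<mm>. maximalideal \<mm> (stalk X x) \<longrightarrow>
        maximalideal {a \<in> carrier (stalk Y (pmap \<phi> x)). stalk_map \<phi> x a \<in> \<mm>}
          (stalk Y (pmap \<phi> x)))"

definition mid :: "('p, 's) rspace \<Rightarrow> ('p, 's, 'p, 's) rs_map" where
  "mid X = \<lparr>src = X, tgt = X, pmap = (\<lambda>x\<in>topspace (rtop X). x),
     smap = (\<lambda>U\<in>{U. openin (rtop X) U}. \<lambda>s\<in>carrier (sections X U). s)\<rparr>"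

definition mcomp ::
    "('q, 't, 'r, 'u) rs_map \<Rightarrow> ('p, 's, 'q, 't) rs_map \<Rightarrow> ('p, 's, 'r, 'u) rs_map"
    (infixr \<open>\<circ>\<^sub>s\<close> 75) where
  "\<psi> \<circ>\<^sub>s \<phi> = \<lparr>src = src \<phi>, tgt = tgt \<psi>,
     pmap = compose (topspace (rtop (src \<phi>))) (pmap \<psi>) (pmap \<phi>),
     smap = (\<lambda>W\<in>{W. openin (rtop (tgt \<psi>)) W}.
       compose (carrier (sections (tgt \<psi>) W)) (smap \<phi> (pre \<psi> W)) (smap \<psi> W))\<rparr>"

definition iso_mor ::
    "('p, 's) rspace \<Rightarrow> ('q, 't) rspace \<Rightarrow> ('p, 's, 'q, 't) rs_map \<Rightarrow> bool" where
  "iso_mor X Y \<phi> \<longleftrightarrow>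
     mor X Y \<phi> \<and> (\<exists>\<psi>. mor Y X \<psi> \<and> \<psi> \<circ>\<^sub>s \<phi> = mid X \<and> \<phi> \<circ>\<^sub>s \<psi> = mid Y)"


section \<open>Spectra and schemes\<close>

definition fraction :: "'a ring \<Rightarrow> 'a set \<Rightarrow> 'a \<Rightarrow> 'a \<Rightarrow> ('a \<times> 'a) set" where
  "fraction A S a s = {(b, t). b \<in> carrier A \<and> t \<in> S \<and>
     (\<exists>u\<in>S. u \<otimes>\<^bsub>A\<^esub> (t \<otimes>\<^bsub>A\<^esub> a) = u \<otimes>\<^bsub>A\<^esub> (s \<otimes>\<^bsub>A\<^esub> b))}"

definition localization :: "'a ring \<Rightarrow> 'a set \<Rightarrow> ('a \<times> 'a) set ring" where
  "localization A S = \<lparr>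
     carrier = {fraction A S a s | a s. a \<in> carrier A \<and> s \<in> S},
     monoid.mult = (\<lambda>x y. \<Union>(a, s)\<in>x. \<Union>(b, t)\<in>y. fraction A S (a \<otimes>\<^bsub>A\<^esub> b) (s \<otimes>\<^bsub>A\<^esub> t)),
     one = fraction A S \<one>\<^bsub>A\<^esub> \<one>\<^bsub>A\<^esub>,
     zero = fraction A S \<zero>\<^bsub>A\<^esub> \<one>\<^bsub>A\<^esub>,
     add = (\<lambda>x y. \<Union>(a, s)\<in>x. \<Union>(b, t)\<in>y.
       fraction A S ((t \<otimes>\<^bsub>A\<^esub> a) \<oplus>\<^bsub>A\<^esub> (s \<otimes>\<^bsub>A\<^esub> b)) (s \<otimes>\<^bsub>A\<^esub> t))\<rparr>"

abbreviation local_at :: "'a ring \<Rightarrow> 'a set \<Rightarrow> ('a \<times> 'a) set ring" where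
  "local_at A \<pp> \<equiv> localization A (carrier A - \<pp>)"

text \<open>Common part of Spec and Proj. The points are a set \<open>P\<close> of prime ideals of \<open>A\<close> with the Zariski
  topology; a section over \<open>U\<close> assigns to every \<open>\<pp> \<in> U\<close> an element of the localization of \<open>A\<close>
  at \<open>\<pp>\<close> and is locally given by a fraction \<open>a / f\<close> with \<open>(a, f) \<in> Q\<close>. For Spec, \<open>Q\<close> contains
  all pairs. For Proj, \<open>Q\<close> consists of the pairs of homogeneous elements of the same degree; the
  degree-0 homogeneous localization is thereby viewed as a subring of the localization.\<close>

definition zariski :: "'a ring \<Rightarrow> 'a set set \<Rightarrow> 'a set topology" where
  "zariski A P = topology_generated_by {{\<pp> \<in> P. f \<notin> \<pp>} | f. f \<in> carrier A}"

definition frac_sections :: "'a ring \<Rightarrow> 'a set set \<Rightarrow> ('a \<times> 'a) set \<Rightarrow>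
    'a set set \<Rightarrow> ('a set \<Rightarrow> ('a \<times> 'a) set) set" where
  "frac_sections A P Q U = {s \<in> (\<Pi>\<^sub>E \<pp>\<in>U. carrier (local_at A \<pp>)).
     \<forall>\<pp>\<in>U. \<exists>V. openin (zariski A P) V \<and> \<pp> \<in> V \<and> V \<subseteq> U \<and>
       (\<exists>(a, f)\<in>Q. \<forall>\<qq>\<in>V. f \<notin> \<qq> \<and> s \<qq> = fraction A (carrier A - \<qq>) a f)}"

definition frac_space :: "'a ring \<Rightarrow> 'a set set \<Rightarrow> ('a \<times> 'a) set \<Rightarrow>
    ('a set, 'a set \<Rightarrow> ('a \<times> 'a) set) rspace" where
  "frac_space A P Q = \<lparr>
     rtop = zariski A P,
     sections = (\<lambda>U. \<lparr>
       carrier = frac_sections A P Q U,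
       monoid.mult = (\<lambda>s t. \<lambda>\<pp>\<in>U. s \<pp> \<otimes>\<^bsub>local_at A \<pp>\<^esub> t \<pp>),
       one = (\<lambda>\<pp>\<in>U. \<one>\<^bsub>local_at A \<pp>\<^esub>),
       zero = (\<lambda>\<pp>\<in>U. \<zero>\<^bsub>local_at A \<pp>\<^esub>),
       add = (\<lambda>s t. \<lambda>\<pp>\<in>U. s \<pp> \<oplus>\<^bsub>local_at A \<pp>\<^esub> t \<pp>)\<rparr>),
     restr = (\<lambda>U V s. restrict s V)\<rparr>"

definition primes :: "'a ring \<Rightarrow> 'a set set" where
  "primes A = {\<pp>. primeideal \<pp> A}"

definition Spec :: "'a ring \<Rightarrow> ('a set, 'a set \<Rightarrow> ('a \<times> 'a) set) rspace" where
  "Spec A = frac_space A (primes A) (carrier A \<times> carrier A)"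

text \<open>The morphism from \<open>frac_space B P Q\<close> to \<open>Spec A\<close> induced by a ring homomorphism
  \<open>h : A \<rightarrow> B\<close>: on points \<open>\<qq> \<mapsto> h\<^sup>-\<^sup>1(\<qq>)\<close>, on fractions \<open>a / f \<mapsto> h(a) / h(f)\<close>.\<close>

definition contract :: "'a ring \<Rightarrow> ('a \<Rightarrow> 'b) \<Rightarrow> 'b set \<Rightarrow> 'a set" where
  "contract A h \<qq> = {a \<in> carrier A. h a \<in> \<qq>}"

definition to_Spec :: "'a ring \<Rightarrow> 'b ring \<Rightarrow> 'b set set \<Rightarrow> ('b \<times> 'b) set \<Rightarrow> ('a \<Rightarrow> 'b) \<Rightarrow>
    ('b set, 'b set \<Rightarrow> ('b \<times> 'b) set, 'a set, 'a set \<Rightarrow> ('a \<times> 'a) set) rs_map" where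
  "to_Spec A B P Q h = \<lparr>
     src = frac_space B P Q,
     tgt = Spec A,
     pmap = (\<lambda>\<qq>\<in>P. contract A h \<qq>),
     smap = (\<lambda>V\<in>{V. openin (rtop (Spec A)) V}. \<lambda>s\<in>carrier (sections (Spec A) V).
       \<lambda>\<qq>\<in>{\<qq> \<in> P. contract A h \<qq> \<in> V}.
         \<Union>(a, f)\<in>s (contract A h \<qq>). fraction B (carrier B - \<qq>) (h a) (h f))\<rparr>"

definition Spec_map :: "'a ring \<Rightarrow> 'b ring \<Rightarrow> ('a \<Rightarrow> 'b) \<Rightarrow>
    ('b set, 'b set \<Rightarrow> ('b \<times> 'b) set, 'a set, 'a set \<Rightarrow> ('a \<times> 'a) set) rs_map" where
  "Spec_map A B h = to_Spec A B (primes B) (carrier B \<times> carrier B) h"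

text \<open>The rings of functions on an affine open subset of \<open>X\<close> can be realized in the type
  of sections of \<open>X\<close>, so quantifying over rings of that type is no restriction.\<close>

definition affine_scheme :: "('p, 's) rspace \<Rightarrow> bool" where
  "affine_scheme X \<longleftrightarrow> (\<exists>(A :: 's ring) \<phi>. cring A \<and> iso_mor X (Spec A) \<phi>)"

definition scheme :: "('p, 's) rspace \<Rightarrow> bool" where
  "scheme X \<longleftrightarrow> locally_ringed_space X \<and>
     (\<forall>x\<in>topspace (rtop X). \<exists>U. openin (rtop X) U \<and> x \<in> U \<and> affine_scheme (open_subspace X U))"

definition integral_scheme :: "('p, 's) rspace \<Rightarrow> bool" where
  "integral_scheme X \<longleftrightarrow> scheme X \<and> topspace (rtop X) \<noteq> {} \<and>
     (\<forall>U. openin (rtop X) U \<longrightarrow> U \<noteq> {} \<longrightarrow> domain (sections X U))"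

text \<open>Universal property of \<open>Y \<times>\<^sub>S Z\<close>. The test schemes \<open>T\<close> live in the same types as the
  fibre product itself; these types are parameters and play the role of a universe.\<close>

definition is_fibre_product ::
    "('p, 's, 'q, 't) rs_map \<Rightarrow> ('p, 's, 'r, 'u) rs_map \<Rightarrow>
     ('q, 't, 'k, 'l) rs_map \<Rightarrow> ('r, 'u, 'k, 'l) rs_map \<Rightarrow> bool" where
  "is_fibre_product \<pi> \<rho> \<eta> \<zeta> \<longleftrightarrow>
     mor (src \<pi>) (src \<eta>) \<pi> \<and> mor (src \<pi>) (src \<zeta>) \<rho> \<and>
     mor (src \<eta>) (tgt \<eta>) \<eta> \<and> mor (src \<zeta>) (tgt \<eta>) \<zeta> \<and> \<eta> \<circ>\<^sub>s \<pi> = \<zeta> \<circ>\<^sub>s \<rho> \<and>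
     (\<forall>(T :: ('p, 's) rspace) u v.
        scheme T \<and> mor T (src \<eta>) u \<and> mor T (src \<zeta>) v \<and> \<eta> \<circ>\<^sub>s u = \<zeta> \<circ>\<^sub>s v \<longrightarrow>
        (\<exists>!w. mor T (src \<pi>) w \<and> \<pi> \<circ>\<^sub>s w = u \<and> \<rho> \<circ>\<^sub>s w = v))"


section \<open>Complex quasi-projective varieties\<close>

definition type_ring :: "'a::comm_ring_1 ring" where
  "type_ring = \<lparr>carrier = UNIV, monoid.mult = (*), one = 1, zero = 0, add = (+)\<rparr>"

abbreviation R_ring :: "real ring" where "R_ring \<equiv> type_ring"
abbreviation C_ring :: "complex ring" where "C_ring \<equiv> type_ring"

text \<open>Polynomials in the variables \<open>x\<^sub>0, \<dots>, x\<^sub>n\<close>, as finitely supported functions on monomials.\<close>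

type_synonym cpoly = "(nat \<Rightarrow>\<^sub>0 nat) \<Rightarrow>\<^sub>0 complex"

definition cpoly_ring :: "nat \<Rightarrow> cpoly ring" where
  "cpoly_ring n = \<lparr>
     carrier = {p. \<forall>m\<in>Poly_Mapping.keys p. Poly_Mapping.keys m \<subseteq> {..n}},
     monoid.mult = (*), one = 1, zero = 0, add = (+)\<rparr>"

definition homogeneous :: "nat \<Rightarrow> cpoly \<Rightarrow> bool" where
  "homogeneous d p \<longleftrightarrow>
     (\<forall>m\<in>Poly_Mapping.keys p. (\<Sum>i\<in>Poly_Mapping.keys m. Poly_Mapping.lookup m i) = d)"

definition variable :: "nat \<Rightarrow> cpoly" where
  "variable i = Poly_Mapping.single (Poly_Mapping.single i 1) 1"

definition homogeneous_ideal :: "nat \<Rightarrow> cpoly set \<Rightarrow> bool" where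
  "homogeneous_ideal n I \<longleftrightarrow> ideal I (cpoly_ring n) \<and>
     I = Idl\<^bsub>cpoly_ring n\<^esub> {p \<in> I. \<exists>d. homogeneous d p}"

definition Proj_points :: "nat \<Rightarrow> cpoly set set" where
  "Proj_points n = {\<pp> \<in> primes (cpoly_ring n). homogeneous_ideal n \<pp> \<and> \<not> variable ` {..n} \<subseteq> \<pp>}"

definition degree_zero_fracs :: "nat \<Rightarrow> (cpoly \<times> cpoly) set" where
  "degree_zero_fracs n = {(a, f). a \<in> carrier (cpoly_ring n) \<and> f \<in> carrier (cpoly_ring n) \<and>
     (\<exists>d. homogeneous d a \<and> homogeneous d f)}"

definition proj_space :: "nat \<Rightarrow> (cpoly set, cpoly set \<Rightarrow> (cpoly \<times> cpoly) set) rspace" where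
  "proj_space n = frac_space (cpoly_ring n) (Proj_points n) (degree_zero_fracs n)"

definition proj_space_structure :: "nat \<Rightarrow>
    (cpoly set, cpoly set \<Rightarrow> (cpoly \<times> cpoly) set,
     complex set, complex set \<Rightarrow> (complex \<times> complex) set) rs_map" where
  "proj_space_structure n =
     to_Spec C_ring (cpoly_ring n) (Proj_points n) (degree_zero_fracs n) (Poly_Mapping.single 0)"

text \<open>Immersions: a closed immersion into an open subscheme.\<close>

definition immersion ::
    "('p, 's) rspace \<Rightarrow> ('q, 't) rspace \<Rightarrow> ('p, 's, 'q, 't) rs_map \<Rightarrow> bool" where
  "immersion X Z \<iota> \<longleftrightarrow> mor X Z \<iota> \<and>
     (\<exists>U. openin (rtop Z) U \<and>
        closedin (subtopology (rtop Z) U) (pmap \<iota> ` topspace (rtop X))) \<and>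
     homeomorphic_map (rtop X) (subtopology (rtop Z) (pmap \<iota> ` topspace (rtop X))) (pmap \<iota>) \<and>
     (\<forall>x\<in>topspace (rtop X).
        stalk_map \<iota> x ` carrier (stalk Z (pmap \<iota> x)) = carrier (stalk X x))"

type_synonym ('p, 's) cscheme_structure =
  "('p, 's, complex set, complex set \<Rightarrow> (complex \<times> complex) set) rs_map"

type_synonym ('p, 's) rscheme_structure =
  "('p, 's, real set, real set \<Rightarrow> (real \<times> real) set) rs_map"

text \<open>\<open>\<rho> : X \<rightarrow> Spec \<complex>\<close> is the structure morphism. A variety is an integral scheme; being separated
  and of finite type over the complex numbers follows from the immersion into projective space.\<close>

definition quasi_projective_variety ::
    "('p, 's) rspace \<Rightarrow> ('p, 's) cscheme_structure \<Rightarrow> bool" where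
  "quasi_projective_variety X \<rho> \<longleftrightarrow> integral_scheme X \<and> mor X (Spec C_ring) \<rho> \<and>
     (\<exists>n \<iota>. immersion X (proj_space n) \<iota> \<and> proj_space_structure n \<circ>\<^sub>s \<iota> = \<rho>)"


section \<open>Real forms and the action of complex conjugation\<close>

definition is_real_form :: "('p, 's) rspace \<Rightarrow> ('p, 's) cscheme_structure \<Rightarrow>
    ('p, 's) rspace \<Rightarrow> ('p, 's) rscheme_structure \<Rightarrow> ('p, 's, 'p, 's) rs_map \<Rightarrow> bool" where
  "is_real_form X \<rho> Y \<eta> \<pi> \<longleftrightarrow> scheme Y \<and> mor Y (Spec R_ring) \<eta> \<and> mor X Y \<pi> \<and>
     is_fibre_product \<pi> \<rho> \<eta> (Spec_map R_ring C_ring complex_of_real)"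

text \<open>\<open>\<sigma>\<^sub>0 = id \<times> c\<close> on \<open>X = Y \<times> Spec \<complex>\<close>, where \<open>\<pi>\<close> and \<open>\<rho>\<close> are the two projections.\<close>

definition is_id_times_conj :: "('p, 's) rspace \<Rightarrow> ('p, 's) cscheme_structure \<Rightarrow>
    ('p, 's, 'p, 's) rs_map \<Rightarrow> ('p, 's, 'p, 's) rs_map \<Rightarrow> bool" where
  "is_id_times_conj X \<rho> \<pi> \<sigma>\<^sub>0 \<longleftrightarrow>
     mor X X \<sigma>\<^sub>0 \<and> \<pi> \<circ>\<^sub>s \<sigma>\<^sub>0 = \<pi> \<and> \<rho> \<circ>\<^sub>s \<sigma>\<^sub>0 = Spec_map C_ring C_ring cnj \<circ>\<^sub>s \<rho>"

definition Aut :: "('p, 's) rspace \<Rightarrow> ('p, 's, 'r, 'u) rs_map \<Rightarrow>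
    ('p, 's, 'p, 's) rs_map monoid" where
  "Aut X \<rho> = \<lparr>carrier = {f. iso_mor X X f \<and> \<rho> \<circ>\<^sub>s f = \<rho>}, monoid.mult = (\<circ>\<^sub>s), one = mid X\<rparr>"

definition sylow_subgroup :: "nat \<Rightarrow> 'a set \<Rightarrow> 'a monoid \<Rightarrow> bool" where
  "sylow_subgroup p H G \<longleftrightarrow> subgroup H G \<and> card H = p ^ multiplicity p (order G)"

definition conj_act ::
    "('p, 's, 'p, 's) rs_map \<Rightarrow> ('p, 's, 'p, 's) rs_map \<Rightarrow> ('p, 's, 'p, 's) rs_map" where
  "conj_act \<sigma>\<^sub>0 f = \<sigma>\<^sub>0 \<circ>\<^sub>s f \<circ>\<^sub>s \<sigma>\<^sub>0"

definition G_stable ::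
    "('p, 's, 'p, 's) rs_map \<Rightarrow> ('p, 's, 'p, 's) rs_map set \<Rightarrow> bool" where
  "G_stable \<sigma>\<^sub>0 H \<longleftrightarrow> (\<forall>f\<in>H. conj_act \<sigma>\<^sub>0 f \<in> H)"

definition Z1 :: "('p, 's) rspace \<Rightarrow> ('p, 's, 'p, 's) rs_map \<Rightarrow>
    ('p, 's, 'p, 's) rs_map set \<Rightarrow> ('p, 's, 'p, 's) rs_map set" where
  "Z1 X \<sigma>\<^sub>0 H = {f \<in> H. f \<circ>\<^sub>s conj_act \<sigma>\<^sub>0 f = mid X}"

definition cohomologous :: "('p, 's) rspace \<Rightarrow> ('p, 's, 'r, 'u) rs_map \<Rightarrow>
    ('p, 's, 'p, 's) rs_map \<Rightarrow> ('p, 's, 'p, 's) rs_map set \<Rightarrow>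
    (('p, 's, 'p, 's) rs_map \<times> ('p, 's, 'p, 's) rs_map) set" where
  "cohomologous X \<rho> \<sigma>\<^sub>0 H = {(f, f'). f \<in> Z1 X \<sigma>\<^sub>0 H \<and> f' \<in> Z1 X \<sigma>\<^sub>0 H \<and>
     (\<exists>h\<in>H. f' = inv\<^bsub>Aut X \<rho>\<^esub> h \<circ>\<^sub>s f \<circ>\<^sub>s conj_act \<sigma>\<^sub>0 h)}"

definition H1 :: "('p, 's) rspace \<Rightarrow> ('p, 's, 'r, 'u) rs_map \<Rightarrow>
    ('p, 's, 'p, 's) rs_map \<Rightarrow> ('p, 's, 'p, 's) rs_map set \<Rightarrow>
    ('p, 's, 'p, 's) rs_map set set" where
  "H1 X \<rho> \<sigma>\<^sub>0 H = Z1 X \<sigma>\<^sub>0 H // cohomologous X \<rho> \<sigma>\<^sub>0 H"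

text \<open>For a real structure \<open>\<sigma>\<close> on \<open>X\<close>, the automorphism group over the real numbers of the real form
  \<open>X / \<langle>\<sigma>\<rangle>\<close>, identified by Galois descent with the centralizer of \<open>\<sigma>\<close> among the automorphisms of \<open>X\<close>
  over the complex numbers.\<close>

definition Aut_real_form :: "('p, 's) rspace \<Rightarrow> ('p, 's, 'r, 'u) rs_map \<Rightarrow>
    ('p, 's, 'p, 's) rs_map \<Rightarrow> ('p, 's, 'p, 's) rs_map set" where
  "Aut_real_form X \<rho> \<sigma> = {h \<in> carrier (Aut X \<rho>). h \<circ>\<^sub>s \<sigma> = \<sigma> \<circ>\<^sub>s h}"

end

theory Submission
  imports Defs
begin

text \<open>\<open>H\<close> acts on its cocycles by \<open>f \<mapsto> h\<^sup>-\<^sup>1 \<circ> f \<circ> (c \<cdot> h)\<close>; the orbits are the classes in \<open>H\<^sup>1\<close> and, since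
  \<open>\<sigma>\<^sub>0 \<circ> \<sigma>\<^sub>0 = id\<close>, the stabilizer of \<open>f\<close> is the centralizer of \<open>f \<circ> \<sigma>\<^sub>0\<close> in \<open>H\<close>. The sum is
  therefore the orbit count of this action. If every element of \<open>H\<close> is a cocycle, then conjugation
  by \<open>\<sigma>\<^sub>0\<close> inverts \<open>H\<close>, and inversion is a homomorphism only on abelian groups. That \<open>\<sigma>\<^sub>0\<close> is an
  involution comes from the uniqueness part of the universal property of the fibre product.\<close>


section \<open>Cocycles of an involution on a finite group\<close>

text \<open>Abstract model of a group of order two acting on \<open>H\<close>:
  \<open>\<theta>\<close> stands for the action of \<open>c\<close>. The counting argument takes
  place at this level, free of geometry.\<close>

locale involuted_group = group +
  fixes \<theta> :: "'a \<Rightarrow> 'a"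
  assumes theta_hom: "\<theta> \<in> hom G G"
    and theta_theta: "x \<in> carrier G \<Longrightarrow> \<theta> (\<theta> x) = x"
begin

lemma theta_closed [simp]: "x \<in> carrier G \<Longrightarrow> \<theta> x \<in> carrier G"
  using theta_hom by (auto simp: hom_def)

lemma theta_mult [simp]:
  "\<lbrakk>x \<in> carrier G; y \<in> carrier G\<rbrakk> \<Longrightarrow> \<theta> (x \<otimes> y) = \<theta> x \<otimes> \<theta> y"
  using theta_hom by (auto simp: hom_def)

lemma theta_one [simp]: "\<theta> \<one> = \<one>"
  by (metis l_one one_closed theta_closed theta_mult r_cancel_one')

lemma theta_inv [simp]: "x \<in> carrier G \<Longrightarrow> \<theta> (inv x) = inv (\<theta> x)"
  by (metis inv_closed inv_equality l_inv theta_closed theta_mult theta_one)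

text \<open>A normalized 1-cocycle of a group of order two is determined by its value at the
  generator, and the cocycle condition becomes this single equation.\<close>

definition cocycles :: "'a set" where
  "cocycles = {f \<in> carrier G. f \<otimes> \<theta> f = \<one>}"

definition twist :: "'a \<Rightarrow> 'a \<Rightarrow> 'a" where
  "twist f h = inv h \<otimes> (f \<otimes> \<theta> h)"

definition cocycle_rel :: "('a \<times> 'a) set" where
  "cocycle_rel = {(f, f'). f \<in> cocycles \<and> f' \<in> cocycles \<and> (\<exists>h\<in>carrier G. f' = twist f h)}"

text \<open>The stabilizer of \<open>f\<close> under \<open>twist\<close>, written without inverses
  so that it can be compared directly with commutation with
  \<open>f \<circ>\<^sub>s \<sigma>\<^sub>0\<close>.\<close>

definition twisted_centralizer :: "'a \<Rightarrow> 'a set" where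
  "twisted_centralizer f = {h \<in> carrier G. h \<otimes> f = f \<otimes> \<theta> h}"

section \<open>Twisting as an action on cocycles\<close>

lemma twist_closed [simp]:
  "\<lbrakk>f \<in> carrier G; h \<in> carrier G\<rbrakk> \<Longrightarrow> twist f h \<in> carrier G"
  by (simp add: twist_def)

lemma twist_one: "f \<in> carrier G \<Longrightarrow> twist f \<one> = f"
  by (simp add: twist_def)

text \<open>Multiplicativity of \<open>\<theta>\<close> makes twisting a right action, so that
  orbits and stabilizers become available.\<close>

lemma twist_twist:
  "\<lbrakk>f \<in> carrier G; h \<in> carrier G; k \<in> carrier G\<rbrakk> \<Longrightarrow> twist (twist f h) k = twist f (h \<otimes> k)"
  by (simp add: twist_def m_assoc inv_mult_group)

text \<open>Because \<open>\<theta>\<close> is an involution, applying it to the twist produces an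
  inner \<open>inv (\<theta> h)\<close> that cancels \<open>\<theta> h\<close>; what remains is the
  conjugate of \<open>f \<otimes> \<theta> f\<close> by \<open>h\<close>.\<close>

lemma twist_cocycle:
  assumes "f \<in> cocycles" "h \<in> carrier G"
  shows "twist f h \<in> cocycles"
proof -
  have f: "f \<in> carrier G" "f \<otimes> \<theta> f = \<one>"
    using assms by (auto simp: cocycles_def)
  \<comment> \<open>Cancellation in the right-nested form to which \<open>m_assoc\<close> brings all
    products.\<close>
  have "\<theta> h \<otimes> (inv (\<theta> h) \<otimes> y) = y" if "y \<in> carrier G" for y
    using that assms(2) by (simp add: m_assoc[symmetric])
  then have "twist f h \<otimes> \<theta> (twist f h) = inv h \<otimes> (f \<otimes> (\<theta> f \<otimes> h))"
    using f(1) assms(2) by (simp add: twist_def m_assoc theta_theta)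
  also have "\<dots> = inv h \<otimes> ((f \<otimes> \<theta> f) \<otimes> h)"
    using f(1) assms(2) by (simp add: m_assoc)
  also have "\<dots> = \<one>"
    using f assms by simp
  finally show ?thesis
    using f assms by (simp add: cocycles_def)
qed

lemma equiv_cocycle_rel: "equiv cocycles cocycle_rel"
proof (rule equivI)
  have carr: "f \<in> carrier G" if "f \<in> cocycles" for f
    using that by (simp add: cocycles_def)
  show "cocycle_rel \<subseteq> cocycles \<times> cocycles"
    by (auto simp: cocycle_rel_def)
  show "refl_on cocycles cocycle_rel"
    unfolding refl_on_def cocycle_rel_def using carr twist_one by (auto intro!: bexI[of _ \<one>])
  show "sym cocycle_rel"
  proof (rule symI)
    fix f f' assume "(f, f') \<in> cocycle_rel"
    then obtain h where h: "f \<in> cocycles" "f' \<in> cocycles" "h \<in> carrier G" "f' = twist f h"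
      by (auto simp: cocycle_rel_def)
    then have "f = twist f' (inv h)"
      using carr by (simp add: twist_twist twist_one)
    with h show "(f', f) \<in> cocycle_rel"
      unfolding cocycle_rel_def by blast
  qed
  show "trans cocycle_rel"
  proof (rule transI)
    fix f g k assume "(f, g) \<in> cocycle_rel" "(g, k) \<in> cocycle_rel"
    then obtain a b where *: "f \<in> cocycles" "g \<in> cocycles" "k \<in> cocycles"
      "a \<in> carrier G" "b \<in> carrier G" "g = twist f a" "k = twist g b"
      by (auto simp: cocycle_rel_def)
    then have "k = twist f (a \<otimes> b)"
      using carr by (simp add: twist_twist)
    with * show "(f, k) \<in> cocycle_rel"
      unfolding cocycle_rel_def by blast
  qed
qed

text \<open>Acting by \<open>inv k\<close> moves the question to the stabilizer of \<open>f\<close>.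
  Hence the fibres of \<open>twist f\<close> are right cosets of this stabilizer.\<close>

lemma twist_eq_iff:
  assumes "f \<in> carrier G" "h \<in> carrier G" "k \<in> carrier G"
  shows "twist f h = twist f k \<longleftrightarrow> h \<otimes> inv k \<in> twisted_centralizer f"
proof -
  have "twist f h = twist f k \<longleftrightarrow> twist f (h \<otimes> inv k) = f"
  proof
    assume "twist f h = twist f k"
    then have "twist (twist f h) (inv k) = twist (twist f k) (inv k)" by simp
    then show "twist f (h \<otimes> inv k) = f"
      using assms by (simp add: twist_twist twist_one)
  next
    assume "twist f (h \<otimes> inv k) = f"
    then have "twist (twist f (h \<otimes> inv k)) k = twist f k" by simp
    then show "twist f h = twist f k"
      using assms by (simp add: twist_twist m_assoc)
  qed
  also have "\<dots> \<longleftrightarrow> h \<otimes> inv k \<in> twisted_centralizer f"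
  proof -
    have "inv m \<otimes> (f \<otimes> \<theta> m) = f \<longleftrightarrow> m \<otimes> f = f \<otimes> \<theta> m" if "m \<in> carrier G" for m
      using assms(1) that inv_solve_left'[of f m "f \<otimes> \<theta> m"] by auto
    then show ?thesis
      using assms by (simp add: twist_def twisted_centralizer_def del: theta_mult)
  qed
  finally show ?thesis .
qed

text \<open>Orbit-stabilizer: every fibre of \<open>twist f\<close> is a translate of the stabilizer
  and so has the same size.\<close>

lemma card_class_mult_card_centralizer:
  assumes fin: "finite (carrier G)" and f: "f \<in> cocycles"
  shows "card (cocycle_rel `` {f}) * card (twisted_centralizer f) = card (carrier G)"
proof -
  have fc: "f \<in> carrier G"
    using f by (simp add: cocycles_def)
  have cl: "cocycle_rel `` {f} = twist f ` carrier G"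
    using f twist_cocycle by (auto simp: cocycle_rel_def)
  have fibre: "card {h \<in> carrier G. twist f h = y} = card (twisted_centralizer f)"
    if "y \<in> twist f ` carrier G" for y
  proof -
    obtain k where k: "k \<in> carrier G" "y = twist f k"
      using \<open>y \<in> twist f ` carrier G\<close> by auto
    have "{h \<in> carrier G. twist f h = y} = (\<lambda>s. s \<otimes> k) ` twisted_centralizer f"
    proof (rule Set.set_eqI, rule iffI)
      fix h assume "h \<in> {h \<in> carrier G. twist f h = y}"
      then have "h \<otimes> inv k \<in> twisted_centralizer f" "h = h \<otimes> inv k \<otimes> k"
        using k fc by (auto simp: twist_eq_iff m_assoc)
      then show "h \<in> (\<lambda>s. s \<otimes> k) ` twisted_centralizer f"
        by blast
    next
      fix h assume "h \<in> (\<lambda>s. s \<otimes> k) ` twisted_centralizer f"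
      then obtain s where s: "s \<in> twisted_centralizer f" "h = s \<otimes> k" by auto
      then have "s \<in> carrier G" by (simp add: twisted_centralizer_def)
      with s k fc show "h \<in> {h \<in> carrier G. twist f h = y}"
        by (simp add: twist_eq_iff m_assoc)
    qed
    moreover have "inj_on (\<lambda>s. s \<otimes> k) (twisted_centralizer f)"
      using k by (auto simp: inj_on_def twisted_centralizer_def)
    ultimately show ?thesis
      by (simp add: card_image)
  qed
  \<comment> \<open>The group order is a sum of ones, grouped by the value of the orbit map.\<close>
  have "card (carrier G) = (\<Sum>y\<in>twist f ` carrier G. card {h \<in> carrier G. twist f h = y})"
    using sum.image_gen[OF fin, of "\<lambda>_. 1::nat" "twist f"] by simp
  also have "\<dots> = card (twist f ` carrier G) * card (twisted_centralizer f)"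
    using fibre by simp
  finally show ?thesis
    by (simp add: cl)
qed

text \<open>Orbit-stabilizer turns each summand into the size of the class over the group order; the
  classes partition the cocycles.\<close>

theorem mass_formula:
  assumes fin: "finite (carrier G)"
    and rep: "\<And>\<xi>. \<xi> \<in> cocycles // cocycle_rel \<Longrightarrow> rep \<xi> \<in> \<xi>"
  shows "(\<Sum>\<xi>\<in>cocycles // cocycle_rel. 1 / real (card (twisted_centralizer (rep \<xi>))))
    = real (card cocycles) / real (card (carrier G))"
proof -
  let ?Q = "cocycles // cocycle_rel"
  have finZ: "finite cocycles"
    using fin by (simp add: cocycles_def)
  have pos: "card (carrier G) > 0"
    using fin by (auto simp: card_gt_0_iff)
  have "1 / real (card (twisted_centralizer (rep \<xi>))) = real (card \<xi>) / real (card (carrier G))"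
    if \<xi>: "\<xi> \<in> ?Q" for \<xi>
  proof -
    obtain f where f: "\<xi> = cocycle_rel `` {f}"
      using \<xi> by (rule quotientE)
    then have rel: "(f, rep \<xi>) \<in> cocycle_rel"
      using rep[OF \<xi>] by simp
    \<comment> \<open>The choice of representative is harmless: whichever element \<open>rep\<close>
      selects spans the same class.\<close>
    then have "cocycle_rel `` {rep \<xi>} = \<xi>"
      by (intro trans[OF equiv_class_eq[OF equiv_cocycle_rel, symmetric] f[symmetric]])
    moreover have "rep \<xi> \<in> cocycles"
      using rel by (simp add: cocycle_rel_def)
    ultimately have *: "card \<xi> * card (twisted_centralizer (rep \<xi>)) = card (carrier G)"
      using card_class_mult_card_centralizer[OF fin, of "rep \<xi>"] by simp
    then have "card (twisted_centralizer (rep \<xi>)) \<noteq> 0" "card \<xi> \<noteq> 0"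
      using pos by (metis less_irrefl mult_0 mult_0_right)+
    then show ?thesis
      by (simp add: *[symmetric])
  qed
  then have "(\<Sum>\<xi>\<in>?Q. 1 / real (card (twisted_centralizer (rep \<xi>))))
      = (\<Sum>\<xi>\<in>?Q. real (card \<xi>)) / real (card (carrier G))"
    by (simp add: sum_divide_distrib)
  also have "(\<Sum>\<xi>\<in>?Q. real (card \<xi>)) = real (card (\<Union>?Q))"
  proof -
    have "finite \<xi>" if "\<xi> \<in> ?Q" for \<xi>
      using that finZ Union_quotient[OF equiv_cocycle_rel] by (metis Sup_upper finite_subset)
    moreover have "pairwise disjnt ?Q"
      using quotient_disj[OF equiv_cocycle_rel] by (auto simp: pairwise_def disjnt_def)
    ultimately show ?thesis
      by (simp add: card_Union_disjoint)
  qed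
  finally show ?thesis
    by (simp add: Union_quotient[OF equiv_cocycle_rel])
qed

lemma comm_group_if_all_cocycles:
  assumes "cocycles = carrier G"
  shows "comm_group G"
proof -
  have th: "\<theta> x = inv x" if "x \<in> carrier G" for x
  proof -
    have "x \<otimes> \<theta> x = \<one>"
      using that assms by (auto simp: cocycles_def)
    then show ?thesis
      using that by (metis inv_comm inv_equality theta_closed)
  qed
  show ?thesis
  proof (rule group_comm_groupI)
    fix x y assume xy: "x \<in> carrier G" "y \<in> carrier G"
    \<comment> \<open>Both sides are \<open>\<theta> (x \<otimes> y)\<close>: one from
      multiplicativity of \<open>\<theta>\<close>, the other from \<open>th\<close> applied to the
      product.\<close>
    then have "inv (y \<otimes> x) = inv (x \<otimes> y)"
      using th theta_mult[of x y] by (simp add: inv_mult_group)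
    then show "x \<otimes> y = y \<otimes> x"
      using xy by (metis inv_inv m_closed)
  qed
qed

end


section \<open>Composition of morphisms\<close>

text \<open>The fragment of \<open>mor\<close> on which associativity of composition rests. With it
  \<open>Spec_conj\<close> can enter compositions without a proof that it is a morphism of locally
  ringed spaces.\<close>

definition well_typed :: "('p, 's, 'q, 't) rs_map \<Rightarrow> bool" where
  "well_typed \<phi> \<longleftrightarrow>
     pmap \<phi> \<in> topspace (rtop (src \<phi>)) \<rightarrow> topspace (rtop (tgt \<phi>)) \<and>
     (\<forall>V. openin (rtop (tgt \<phi>)) V \<longrightarrow> openin (rtop (src \<phi>)) (pre \<phi> V) \<and>
        smap \<phi> V \<in> carrier (sections (tgt \<phi>) V) \<rightarrow> carrier (sections (src \<phi>) (pre \<phi> V)))"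

lemma mor_src: "mor X Y \<phi> \<Longrightarrow> src \<phi> = X"
  and mor_tgt: "mor X Y \<phi> \<Longrightarrow> tgt \<phi> = Y"
  by (simp_all add: mor_def)

section \<open>Associativity and identities for composition\<close>

lemma mor_well_typed: "mor X Y \<phi> \<Longrightarrow> well_typed \<phi>"
  unfolding mor_def well_typed_def pre_def
  by (auto simp: continuous_map_def ring_hom_def)

lemma mcomp_simps [simp]:
  "src (\<psi> \<circ>\<^sub>s \<phi>) = src \<phi>" "tgt (\<psi> \<circ>\<^sub>s \<phi>) = tgt \<psi>"
  by (simp_all add: mcomp_def)

lemma pmap_mcomp:
  "x \<in> topspace (rtop (src \<phi>)) \<Longrightarrow> pmap (\<psi> \<circ>\<^sub>s \<phi>) x = pmap \<psi> (pmap \<phi> x)"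
  by (simp add: mcomp_def compose_def)

lemma smap_mcomp:
  "\<lbrakk>openin (rtop (tgt \<psi>)) V; s \<in> carrier (sections (tgt \<psi>) V)\<rbrakk>
    \<Longrightarrow> smap (\<psi> \<circ>\<^sub>s \<phi>) V s = smap \<phi> (pre \<psi> V) (smap \<psi> V s)"
  by (simp add: mcomp_def compose_def)

lemma pre_mcomp:
  assumes "well_typed \<phi>" "src \<psi> = tgt \<phi>"
  shows "pre (\<psi> \<circ>\<^sub>s \<phi>) V = pre \<phi> (pre \<psi> V)"
  using assms by (auto simp: pre_def pmap_mcomp well_typed_def Pi_iff)

lemma mcomp_assoc:
  assumes "well_typed \<chi>" "well_typed \<psi>" "well_typed \<phi>"
    and "src \<chi> = tgt \<psi>" "src \<psi> = tgt \<phi>"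
  shows "(\<chi> \<circ>\<^sub>s \<psi>) \<circ>\<^sub>s \<phi> = \<chi> \<circ>\<^sub>s (\<psi> \<circ>\<^sub>s \<phi>)"
proof (rule rs_map.equality)
  show "pmap ((\<chi> \<circ>\<^sub>s \<psi>) \<circ>\<^sub>s \<phi>) = pmap (\<chi> \<circ>\<^sub>s (\<psi> \<circ>\<^sub>s \<phi>))"
    using assms by (auto simp: mcomp_def compose_def fun_eq_iff well_typed_def Pi_iff)
  have "smap ((\<chi> \<circ>\<^sub>s \<psi>) \<circ>\<^sub>s \<phi>) V s = smap (\<chi> \<circ>\<^sub>s (\<psi> \<circ>\<^sub>s \<phi>)) V s" for V s
  proof (cases "openin (rtop (tgt \<chi>)) V \<and> s \<in> carrier (sections (tgt \<chi>) V)")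
    case True
    then have "openin (rtop (tgt \<psi>)) (pre \<chi> V)"
      "smap \<chi> V s \<in> carrier (sections (tgt \<psi>) (pre \<chi> V))"
      using assms by (auto simp: well_typed_def Pi_iff)
    with True show ?thesis
      using assms by (simp add: smap_mcomp pre_mcomp)
  next
    \<comment> \<open>Off the domain both composites take the same default value, so the equality of
      records is exact.\<close>
    case False
    then show ?thesis
      by (auto simp: mcomp_def compose_def)
  qed
  then show "smap ((\<chi> \<circ>\<^sub>s \<psi>) \<circ>\<^sub>s \<phi>) = smap (\<chi> \<circ>\<^sub>s (\<psi> \<circ>\<^sub>s \<phi>))"
    by (intro ext)
qed (simp_all add: mcomp_def)

lemma mor_mcomp_assoc:
  assumes "mor Z W \<chi>" "mor Y Z \<psi>" "mor X Y \<phi>"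
  shows "(\<chi> \<circ>\<^sub>s \<psi>) \<circ>\<^sub>s \<phi> = \<chi> \<circ>\<^sub>s (\<psi> \<circ>\<^sub>s \<phi>)"
  using assms by (intro mcomp_assoc) (auto simp: mor_src mor_tgt intro: mor_well_typed)

lemma pre_mid: "openin (rtop X) V \<Longrightarrow> pre (mid X) V = V"
  using openin_subset by (fastforce simp: pre_def mid_def)

text \<open>The extensionality clauses of \<open>mor\<close> matter here: composing with
  \<open>mid\<close> restricts the components to their domains, which leaves an extensional map
  unchanged.\<close>

lemma mid_mcomp:
  assumes "mor X Y \<phi>"
  shows "mid Y \<circ>\<^sub>s \<phi> = \<phi>"
proof (rule rs_map.equality)
  have top: "pmap \<phi> x \<in> topspace (rtop Y)" if "x \<in> topspace (rtop X)" for x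
    using assms that by (auto simp: mor_def continuous_map_def)
  show "pmap (mid Y \<circ>\<^sub>s \<phi>) = pmap \<phi>"
    using assms top by (auto simp: mor_def mcomp_def compose_def mid_def fun_eq_iff extensional_def)
  show "smap (mid Y \<circ>\<^sub>s \<phi>) = smap \<phi>"
  proof (intro ext)
    fix V s
    show "smap (mid Y \<circ>\<^sub>s \<phi>) V s = smap \<phi> V s"
      using assms pre_mid[of Y V]
      by (auto simp: mor_def mcomp_def compose_def mid_def extensional_def)
  qed
qed (use assms in \<open>simp_all add: mor_def mid_def mcomp_def\<close>)

lemma mcomp_mid:
  assumes "mor X Y \<phi>"
  shows "\<phi> \<circ>\<^sub>s mid X = \<phi>"
proof (rule rs_map.equality)
  show "pmap (\<phi> \<circ>\<^sub>s mid X) = pmap \<phi>"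
    using assms by (auto simp: mor_def mcomp_def compose_def mid_def fun_eq_iff extensional_def)
  show "smap (\<phi> \<circ>\<^sub>s mid X) = smap \<phi>"
  proof (intro ext)
    fix V s
    show "smap (\<phi> \<circ>\<^sub>s mid X) V s = smap \<phi> V s"
      using assms mor_well_typed[OF assms]
      by (auto simp: mor_def well_typed_def Pi_iff mcomp_def compose_def mid_def extensional_def)
  qed
qed (use assms in \<open>simp_all add: mor_def mid_def mcomp_def\<close>)

section \<open>Germs and stalk maps\<close>

lemma (in ringed_space) germ_eqI:
  assumes U: "openin (rtop X) U" "s \<in> carrier (sections X U)"
    and V: "openin (rtop X) V" "t \<in> carrier (sections X V)"
    and W: "openin (rtop X) W" "x \<in> W" "W \<subseteq> U \<inter> V" "restr X U W s = restr X V W t"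
  shows "germ X x U s = germ X x V t"
proof -
  \<comment> \<open>The hypotheses are symmetric in the two sections, so one inclusion, generalized
    over them, gives both.\<close>
  have le: "germ X x U s \<subseteq> germ X x V t"
    if U: "openin (rtop X) U" "s \<in> carrier (sections X U)"
      and V: "openin (rtop X) V" "t \<in> carrier (sections X V)"
      and W: "W \<subseteq> U \<inter> V" "restr X U W s = restr X V W t" for U V s t
  proof (clarsimp simp: germ_def)
    fix V' t' W'
    assume *: "openin (rtop X) V'" "x \<in> V'" "t' \<in> carrier (sections X V')"
      "openin (rtop X) W'" "x \<in> W'" "W' \<subseteq> U" "W' \<subseteq> V'" "restr X U W' s = restr X V' W' t'"
    \<comment> \<open>Agreement of \<open>s\<close> with \<open>t\<close> on \<open>W\<close> and
      with \<open>t'\<close> on \<open>W'\<close> is compared on the intersection, which still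
      contains \<open>x\<close>.\<close>
    have o: "openin (rtop X) (W \<inter> W')"
      using * assms(5) by auto
    have "restr X V (W \<inter> W') t = restr X W (W \<inter> W') (restr X V W t)"
      using restr_restr[of V W "W \<inter> W'" t] V W o assms(5) by simp
    also have "\<dots> = restr X U (W \<inter> W') s"
      using restr_restr[of U W "W \<inter> W'" s] U W o assms(5) by simp
    also have "\<dots> = restr X W' (W \<inter> W') (restr X U W' s)"
      using restr_restr[of U W' "W \<inter> W'" s] U * o by simp
    also have "\<dots> = restr X V' (W \<inter> W') t'"
      using restr_restr[of V' W' "W \<inter> W'" t'] * o by simp
    finally show "\<exists>W. openin (rtop X) W \<and> x \<in> W \<and> W \<subseteq> V \<and> W \<subseteq> V' \<and>
        restr X V W t = restr X V' W t'"
      using o * W assms(6) by (intro exI[of _ "W \<inter> W'"]) auto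
  qed
  show ?thesis
    using le[OF U V W(3,4)] le[OF V U] W by (simp add: Int_commute)
qed

lemma (in ringed_space) germ_self:
  "\<lbrakk>openin (rtop X) U; x \<in> U; s \<in> carrier (sections X U)\<rbrakk> \<Longrightarrow> (U, s) \<in> germ X x U s"
  by (auto simp: germ_def)

text \<open>Locality on stalks is left out here, so that germs can be computed for a composition
  before it is known to be a morphism.\<close>

lemma stalk_map_germ:
  assumes X: "ringed_space X" and Y: "ringed_space Y"
    and \<phi>: "well_typed \<phi>" "src \<phi> = X" "tgt \<phi> = Y"
    and nat: "\<And>V W s. \<lbrakk>openin (rtop Y) V; openin (rtop Y) W; W \<subseteq> V; s \<in> carrier (sections Y V)\<rbrakk>
      \<Longrightarrow> smap \<phi> W (restr Y V W s) = restr X (pre \<phi> V) (pre \<phi> W) (smap \<phi> V s)"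
    and x: "x \<in> topspace (rtop X)"
    and U: "openin (rtop Y) U" "pmap \<phi> x \<in> U" "s \<in> carrier (sections Y U)"
  shows "stalk_map \<phi> x (germ Y (pmap \<phi> x) U s) = germ X x (pre \<phi> U) (smap \<phi> U s)"
proof -
  interpret X: ringed_space X by fact
  interpret Y: ringed_space Y by fact
  \<comment> \<open>\<open>stalk_map\<close> is a union over all representatives of a germ. By
    naturality all its members coincide, and the germ is nonempty, so the union is this common
    value.\<close>
  have same: "germ X x (pre \<phi> V) (smap \<phi> V t) = germ X x (pre \<phi> U) (smap \<phi> U s)"
    if Vt: "(V, t) \<in> germ Y (pmap \<phi> x) U s" for V t
  proof -
    obtain W where V: "openin (rtop Y) V" "t \<in> carrier (sections Y V)"
      and W: "openin (rtop Y) W" "pmap \<phi> x \<in> W" "W \<subseteq> U" "W \<subseteq> V"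
        "restr Y U W s = restr Y V W t"
      using Vt by (auto simp: germ_def)
    show ?thesis
    proof (rule X.germ_eqI)
      show "openin (rtop X) (pre \<phi> V)" "smap \<phi> V t \<in> carrier (sections X (pre \<phi> V))"
        "openin (rtop X) (pre \<phi> U)" "smap \<phi> U s \<in> carrier (sections X (pre \<phi> U))"
        "openin (rtop X) (pre \<phi> W)"
        using V U W \<phi> by (auto simp: well_typed_def Pi_iff)
      show "x \<in> pre \<phi> W" "pre \<phi> W \<subseteq> pre \<phi> V \<inter> pre \<phi> U"
        using W x \<phi>(2) by (auto simp: pre_def)
      show "restr X (pre \<phi> V) (pre \<phi> W) (smap \<phi> V t) = restr X (pre \<phi> U) (pre \<phi> W) (smap \<phi> U s)"
        using nat[of V W t] nat[of U W s] V U W by simp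
    qed
  qed
  show ?thesis
    unfolding stalk_map_def \<phi>(2)
  proof (rule SUP_eq_const)
    show "germ Y (pmap \<phi> x) U s \<noteq> {}"
      using Y.germ_self[OF U] by blast
    fix p assume "p \<in> germ Y (pmap \<phi> x) U s"
    then show "(case p of (V, t) \<Rightarrow> germ X x (pre \<phi> V) (smap \<phi> V t))
        = germ X x (pre \<phi> U) (smap \<phi> U s)"
      using same[of "fst p" "snd p"] by (cases p) simp
  qed
qed

section \<open>Identity and composite morphisms\<close>

lemma mor_natural:
  "\<lbrakk>mor X Y \<phi>; openin (rtop Y) V; openin (rtop Y) W; W \<subseteq> V; s \<in> carrier (sections Y V)\<rbrakk>
    \<Longrightarrow> smap \<phi> W (restr Y V W s) = restr X (pre \<phi> V) (pre \<phi> W) (smap \<phi> V s)"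
  by (simp add: mor_def)

text \<open>The substantial clause is locality: the stalk map of a composite is the composite of the
  stalk maps, so a maximal ideal is pulled back in two steps.\<close>

lemma mor_mcomp:
  assumes X: "ringed_space X" and Y: "ringed_space Y" and Z: "ringed_space Z"
    and \<phi>: "mor X Y \<phi>" and \<psi>: "mor Y Z \<psi>"
  shows "mor X Z (\<psi> \<circ>\<^sub>s \<phi>)"
proof -
  interpret Z: ringed_space Z by fact
  note wt = mor_well_typed[OF \<phi>] mor_well_typed[OF \<psi>]
  note st [simp] = mor_src[OF \<phi>] mor_tgt[OF \<phi>] mor_src[OF \<psi>] mor_tgt[OF \<psi>]
  have pre [simp]: "pre (\<psi> \<circ>\<^sub>s \<phi>) V = pre \<phi> (pre \<psi> V)" for V
    using wt by (simp add: pre_mcomp)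
  have op\<psi>: "openin (rtop Y) (pre \<psi> V)" if "openin (rtop Z) V" for V
    using wt that by (simp add: well_typed_def)
  have sm\<psi>: "smap \<psi> V s \<in> carrier (sections Y (pre \<psi> V))"
    if "openin (rtop Z) V" "s \<in> carrier (sections Z V)" for V s
    using wt that by (auto simp: well_typed_def)
  have top: "pmap \<phi> x \<in> topspace (rtop Y)" if "x \<in> topspace (rtop X)" for x
    using wt that by (auto simp: well_typed_def)
  have sm: "smap (\<psi> \<circ>\<^sub>s \<phi>) V s = smap \<phi> (pre \<psi> V) (smap \<psi> V s)"
    if "openin (rtop Z) V" "s \<in> carrier (sections Z V)" for V s
    using that by (simp add: smap_mcomp)
  have wtc: "well_typed (\<psi> \<circ>\<^sub>s \<phi>)"
    using wt by (auto simp: well_typed_def Pi_iff pmap_mcomp sm)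
  have nat: "smap (\<psi> \<circ>\<^sub>s \<phi>) W (restr Z V W s)
      = restr X (pre (\<psi> \<circ>\<^sub>s \<phi>) V) (pre (\<psi> \<circ>\<^sub>s \<phi>) W) (smap (\<psi> \<circ>\<^sub>s \<phi>) V s)"
    if V: "openin (rtop Z) V" and W: "openin (rtop Z) W" "W \<subseteq> V"
      and s: "s \<in> carrier (sections Z V)" for V W s
  proof -
    have "restr Z V W s \<in> carrier (sections Z W)"
      using Z.restr_hom[OF V W] s by (auto simp: ring_hom_def)
    moreover have "pre \<psi> W \<subseteq> pre \<psi> V"
      using W by (auto simp: pre_def)
    ultimately show ?thesis
      using V W s
      by (simp add: sm mor_natural[OF \<psi>] mor_natural[OF \<phi>] op\<psi> sm\<psi>)
  qed
  have hom: "smap (\<psi> \<circ>\<^sub>s \<phi>) V \<in> ring_hom (sections Z V) (sections X (pre (\<psi> \<circ>\<^sub>s \<phi>) V))"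
    if V: "openin (rtop Z) V" for V
  proof -
    \<comment> \<open>The ring laws supply the closure under sums and products that the conditional
      rule \<open>sm\<close> requires.\<close>
    interpret cring "sections Z V"
      using Z.sections_cring[OF V] .
    have "smap \<phi> (pre \<psi> V) \<circ> smap \<psi> V \<in> ring_hom (sections Z V) (sections X (pre \<phi> (pre \<psi> V)))"
      using V op\<psi>[OF V] \<phi> \<psi> by (intro ring_hom_trans) (auto simp: mor_def)
    then show ?thesis
      by (simp add: ring_hom_def Pi_iff sm[OF V])
  qed
  have loc: "maximalideal {a \<in> carrier (stalk Z (pmap (\<psi> \<circ>\<^sub>s \<phi>) x)).
      stalk_map (\<psi> \<circ>\<^sub>s \<phi>) x a \<in> \<mm>} (stalk Z (pmap (\<psi> \<circ>\<^sub>s \<phi>) x))"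
    if x: "x \<in> topspace (rtop X)" and \<mm>: "maximalideal \<mm> (stalk X x)" for x \<mm>
  proof -
    let ?y = "pmap \<phi> x"
    \<comment> \<open>The intermediate ideal, maximal by locality of \<open>\<phi>\<close>; locality
      of \<open>\<psi>\<close> is then applied to it.\<close>
    let ?\<nn> = "{a \<in> carrier (stalk Y ?y). stalk_map \<phi> x a \<in> \<mm>}"
    have y: "?y \<in> topspace (rtop Y)" and z: "pmap (\<psi> \<circ>\<^sub>s \<phi>) x = pmap \<psi> ?y"
      using x top by (simp_all add: pmap_mcomp)
    have "stalk_map (\<psi> \<circ>\<^sub>s \<phi>) x a = stalk_map \<phi> x (stalk_map \<psi> ?y a)
        \<and> stalk_map \<psi> ?y a \<in> carrier (stalk Y ?y)"
      if a: "a \<in> carrier (stalk Z (pmap \<psi> ?y))" for a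
    proof -
      obtain U s where U: "openin (rtop Z) U" "pmap \<psi> ?y \<in> U" "s \<in> carrier (sections Z U)"
        and a_eq: "a = germ Z (pmap \<psi> ?y) U s"
        using a by (auto simp: stalk_def)
      have yU: "?y \<in> pre \<psi> U"
        using U y by (simp add: pre_def)
      have 1: "stalk_map \<psi> ?y a = germ Y ?y (pre \<psi> U) (smap \<psi> U s)"
        unfolding a_eq
        using stalk_map_germ[OF Y Z wt(2) _ _ mor_natural[OF \<psi>] y U] by simp
      have 2: "stalk_map \<phi> x (germ Y ?y (pre \<psi> U) (smap \<psi> U s))
          = germ X x (pre \<phi> (pre \<psi> U)) (smap \<phi> (pre \<psi> U) (smap \<psi> U s))"
        using stalk_map_germ[OF X Y wt(1) _ _ mor_natural[OF \<phi>] x op\<psi>[OF U(1)] yU sm\<psi>[OF U(1,3)]]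
        by simp
      have 3: "stalk_map (\<psi> \<circ>\<^sub>s \<phi>) x a
          = germ X x (pre \<phi> (pre \<psi> U)) (smap \<phi> (pre \<psi> U) (smap \<psi> U s))"
        unfolding a_eq
        using stalk_map_germ[OF X Z wtc _ _ nat x, of U s] U z by (simp add: sm)
      have "germ Y ?y (pre \<psi> U) (smap \<psi> U s) \<in> carrier (stalk Y ?y)"
        using op\<psi>[OF U(1)] yU sm\<psi>[OF U(1,3)] by (auto simp: stalk_def)
      then show ?thesis
        using 1 2 3 by simp
    qed
    then have "{a \<in> carrier (stalk Z (pmap \<psi> ?y)). stalk_map (\<psi> \<circ>\<^sub>s \<phi>) x a \<in> \<mm>}
        = {a \<in> carrier (stalk Z (pmap \<psi> ?y)). stalk_map \<psi> ?y a \<in> ?\<nn>}"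
      by auto
    moreover have "maximalideal ?\<nn> (stalk Y ?y)"
      using \<phi> x \<mm> by (simp add: mor_def)
    then have "maximalideal {a \<in> carrier (stalk Z (pmap \<psi> ?y)). stalk_map \<psi> ?y a \<in> ?\<nn>}
        (stalk Z (pmap \<psi> ?y))"
      using \<psi> y unfolding mor_def by blast
    ultimately show ?thesis
      by (simp only: z)
  qed
  have "continuous_map (rtop X) (rtop Z) (pmap \<psi> \<circ> pmap \<phi>)"
    using \<phi> \<psi> by (intro continuous_map_compose) (auto simp: mor_def)
  then have "continuous_map (rtop X) (rtop Z) (pmap (\<psi> \<circ>\<^sub>s \<phi>))"
    by (rule continuous_map_eq) (simp add: pmap_mcomp)
  moreover have "pmap (\<psi> \<circ>\<^sub>s \<phi>) \<in> extensional (topspace (rtop X))"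
    "smap (\<psi> \<circ>\<^sub>s \<phi>) \<in> extensional {V. openin (rtop Z) V}"
    "\<And>V. openin (rtop Z) V \<Longrightarrow> smap (\<psi> \<circ>\<^sub>s \<phi>) V \<in> extensional (carrier (sections Z V))"
    by (simp_all add: mcomp_def)
  ultimately show ?thesis
    unfolding mor_def using hom nat loc by (simp del: pre)
qed

lemma mor_mid:
  assumes "ringed_space X"
  shows "mor X X (mid X)"
proof -
  interpret ringed_space X by fact
  have st [simp]: "src (mid X) = X" "tgt (mid X) = X"
    by (simp_all add: mid_def)
  have sm [simp]: "smap (mid X) V s = s"
    if "openin (rtop X) V" "s \<in> carrier (sections X V)" for V s
    using that by (simp add: mid_def)
  have carr: "restr X V W s \<in> carrier (sections X W)"
    if "openin (rtop X) V" "openin (rtop X) W" "W \<subseteq> V" "s \<in> carrier (sections X V)" for V W s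
    using restr_hom[OF that(1-3)] that(4) by (auto simp: ring_hom_def)
  have nat: "smap (mid X) W (restr X V W s)
      = restr X (pre (mid X) V) (pre (mid X) W) (smap (mid X) V s)"
    if "openin (rtop X) V" "openin (rtop X) W" "W \<subseteq> V" "s \<in> carrier (sections X V)" for V W s
    using that carr by (simp add: pre_mid)
  have wt: "well_typed (mid X)"
    by (auto simp: well_typed_def pre_mid) (simp add: mid_def)
  have hom: "smap (mid X) V \<in> ring_hom (sections X V) (sections X (pre (mid X) V))"
    if V: "openin (rtop X) V" for V
  proof -
    interpret cring "sections X V"
      using sections_cring[OF V] .
    show ?thesis
      using V by (simp add: ring_hom_def pre_mid)
  qed
  have loc: "maximalideal {a \<in> carrier (stalk X (pmap (mid X) x)). stalk_map (mid X) x a \<in> \<mm>}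
      (stalk X (pmap (mid X) x))"
    if x: "x \<in> topspace (rtop X)" and \<mm>: "maximalideal \<mm> (stalk X x)" for x \<mm>
  proof -
    have pm: "pmap (mid X) x = x"
      using x by (simp add: mid_def)
    \<comment> \<open>The stalk map fixes every germ, so each maximal ideal is its own
      preimage.\<close>
    have "stalk_map (mid X) x a = a" if a: "a \<in> carrier (stalk X x)" for a
    proof -
      obtain U s where U: "openin (rtop X) U" "x \<in> U" "s \<in> carrier (sections X U)"
        and "a = germ X x U s"
        using a by (auto simp: stalk_def)
      then show ?thesis
        using stalk_map_germ[OF assms assms wt _ _ nat x, of U s] by (simp add: pm pre_mid)
    qed
    then have "{a \<in> carrier (stalk X x). stalk_map (mid X) x a \<in> \<mm>} = \<mm>"
      using ideal.Icarr[OF maximalideal.axioms(1)[OF \<mm>]] by auto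
    then show ?thesis
      using \<mm> pm by simp
  qed
  have "continuous_map (rtop X) (rtop X) (pmap (mid X))"
    using continuous_map_id by (rule continuous_map_eq) (simp add: mid_def)
  moreover have "pmap (mid X) \<in> extensional (topspace (rtop X))"
    "smap (mid X) \<in> extensional {V. openin (rtop X) V}"
    "\<And>V. openin (rtop X) V \<Longrightarrow> smap (mid X) V \<in> extensional (carrier (sections X V))"
    by (simp_all add: mid_def)
  ultimately show ?thesis
    unfolding mor_def using hom nat loc by simp
qed


section \<open>Complex conjugation on the spectrum of the complex numbers\<close>

lemma primes_C_ring: "primes C_ring \<subseteq> {{0}}"
proof
  fix \<pp> :: "complex set" assume "\<pp> \<in> primes C_ring"
  then interpret P: primeideal \<pp> C_ring
    by (simp add: primes_def)
  have "0 \<in> \<pp>"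
    using additive_subgroup.zero_closed[OF P.additive_subgroup_axioms] by (simp add: type_ring_def)
  moreover have "z = 0" if "z \<in> \<pp>" for z
  proof (rule ccontr)
    assume "z \<noteq> 0"
    \<comment> \<open>In a field a nonzero element generates everything:
      \<open>w = (w / z) * z\<close>.\<close>
    then have "w \<in> \<pp>" for w
      using P.I_l_closed[OF that, of "w / z"] by (simp add: type_ring_def)
    then show False
      using P.I_notcarr by (auto simp: type_ring_def)
  qed
  ultimately show "\<pp> \<in> {{0}}"
    by auto
qed

text \<open>Denominators are invertible, so a fraction class is determined by the complex number
  \<open>a / f\<close>.\<close>

lemma fraction_C_ring:
  "f \<noteq> 0 \<Longrightarrow> fraction C_ring (carrier C_ring - {0}) a f = {(b, t). t \<noteq> 0 \<and> b = t * (a / f)}"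
  by (auto simp: fraction_def type_ring_def field_simps)

text \<open>Well-definedness of conjugation on fractions: all representatives have the same
  quotient, hence so do their conjugates, and the union collapses.\<close>

lemma conj_fraction_C_ring:
  assumes "f \<noteq> 0"
  shows "(\<Union>(b, t)\<in>fraction C_ring (carrier C_ring - {0}) a f.
      fraction C_ring (carrier C_ring - {0}) (cnj b) (cnj t))
    = fraction C_ring (carrier C_ring - {0}) (cnj a) (cnj f)"
  unfolding fraction_C_ring[OF assms]
proof (rule SUP_eq_const)
  show "{(b, t). t \<noteq> 0 \<and> b = t * (a / f)} \<noteq> {}"
    by (auto intro: exI[of _ 1])
  fix p assume "p \<in> {(b, t). t \<noteq> 0 \<and> b = t * (a / f)}"
  then show "(case p of (b, t) \<Rightarrow> fraction C_ring (carrier C_ring - {0}) (cnj b) (cnj t))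
      = fraction C_ring (carrier C_ring - {0}) (cnj a) (cnj f)"
    using assms by (cases p) (auto simp: fraction_C_ring)
qed

section \<open>The map of spectra induced by complex conjugation\<close>

abbreviation Spec_conj ::
    "(complex set, complex set \<Rightarrow> (complex \<times> complex) set,
      complex set, complex set \<Rightarrow> (complex \<times> complex) set) rs_map" where
  "Spec_conj \<equiv> Spec_map C_ring C_ring cnj"

lemma contract_cnj: "contract C_ring cnj {0} = {0}"
  by (auto simp: contract_def type_ring_def)

lemma Spec_conj_src_tgt [simp]: "src Spec_conj = Spec C_ring" "tgt Spec_conj = Spec C_ring"
  by (simp_all add: Spec_map_def to_Spec_def Spec_def)

lemma rtop_Spec: "rtop (Spec A) = zariski A (primes A)"
  by (simp add: Spec_def frac_space_def)

lemma carrier_sections_Spec: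
  "carrier (sections (Spec A) V) = frac_sections A (primes A) (carrier A \<times> carrier A) V"
  by (simp add: Spec_def frac_space_def)

lemma topspace_Spec: "topspace (rtop (Spec A)) \<subseteq> primes A"
  by (auto simp: rtop_Spec zariski_def)

text \<open>The zero ideal is stable under conjugation; thus only the action on sections is
  nontrivial.\<close>

lemma pmap_Spec_conj: "\<pp> \<in> primes C_ring \<Longrightarrow> pmap Spec_conj \<pp> = \<pp>"
  using primes_C_ring contract_cnj by (force simp: Spec_map_def to_Spec_def)

lemma openin_Spec_subset: "openin (rtop (Spec A)) V \<Longrightarrow> V \<subseteq> primes A"
  using openin_subset topspace_Spec by blast

lemma pre_Spec_conj:
  assumes "openin (rtop (Spec C_ring)) V"
  shows "pre Spec_conj V = V"
  using topspace_Spec[of C_ring] openin_subset[OF assms] pmap_Spec_conj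
  by (auto simp: pre_def subset_iff)

text \<open>The local description of a section near \<open>\<pp>\<close>, evaluated at
  \<open>\<pp>\<close> itself; its denominator avoids the zero ideal.\<close>

lemma sections_Spec_C_fraction:
  assumes V: "openin (rtop (Spec C_ring)) V" and s: "s \<in> carrier (sections (Spec C_ring) V)"
    and \<pp>: "\<pp> \<in> V"
  obtains a f where "f \<noteq> 0" "s \<pp> = fraction C_ring (carrier C_ring - {0}) a f"
proof -
  have "\<pp> = {0}"
    using openin_Spec_subset[OF V] primes_C_ring \<pp> by blast
  then show ?thesis
    using s \<pp> that unfolding carrier_sections_Spec frac_sections_def by fastforce
qed

lemma smap_Spec_conj:
  assumes V: "openin (rtop (Spec C_ring)) V" and s: "s \<in> carrier (sections (Spec C_ring) V)"
  shows "smap Spec_conj V s = (\<lambda>\<pp>\<in>V. \<Union>(a, f)\<in>s \<pp>.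
    fraction C_ring (carrier C_ring - {0}) (cnj a) (cnj f))"
proof -
  have P: "\<pp> = {0}" if "\<pp> \<in> primes C_ring" for \<pp>
    using that primes_C_ring by blast
  then have "{\<pp> \<in> primes C_ring. contract C_ring cnj \<pp> \<in> V} = V"
    using openin_Spec_subset[OF V] contract_cnj by (auto simp: subset_iff)
  then have "smap Spec_conj V s = (\<lambda>\<pp>\<in>V. \<Union>(a, f)\<in>s (contract C_ring cnj \<pp>).
      fraction C_ring (carrier C_ring - \<pp>) (cnj a) (cnj f))"
    using V s by (simp add: Spec_map_def to_Spec_def)
  also have "\<dots> = (\<lambda>\<pp>\<in>V. \<Union>(a, f)\<in>s \<pp>.
      fraction C_ring (carrier C_ring - {0}) (cnj a) (cnj f))"
  proof (rule restrict_ext)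
    fix \<pp> assume "\<pp> \<in> V"
    then have "\<pp> = {0}"
      using P openin_Spec_subset[OF V] by blast
    then show "(\<Union>(a, f)\<in>s (contract C_ring cnj \<pp>).
        fraction C_ring (carrier C_ring - \<pp>) (cnj a) (cnj f))
      = (\<Union>(a, f)\<in>s \<pp>. fraction C_ring (carrier C_ring - {0}) (cnj a) (cnj f))"
      by (simp add: contract_cnj)
  qed
  finally show ?thesis .
qed

lemma smap_Spec_conj_fraction:
  assumes "openin (rtop (Spec C_ring)) V" "s \<in> carrier (sections (Spec C_ring) V)" "\<pp> \<in> V"
    and "f \<noteq> 0" "s \<pp> = fraction C_ring (carrier C_ring - {0}) a f"
  shows "smap Spec_conj V s \<pp> = fraction C_ring (carrier C_ring - {0}) (cnj a) (cnj f)"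
  using assms by (simp add: smap_Spec_conj conj_fraction_C_ring)

lemma smap_Spec_conj_closed:
  assumes V: "openin (rtop (Spec C_ring)) V" and s: "s \<in> carrier (sections (Spec C_ring) V)"
  shows "smap Spec_conj V s \<in> carrier (sections (Spec C_ring) V)"
proof -
  have P: "\<pp> = {0}" if "\<pp> \<in> V" for \<pp>
    using that openin_Spec_subset[OF V] primes_C_ring by blast
  have "smap Spec_conj V s \<in> extensional V"
    using V s by (simp add: smap_Spec_conj)
  moreover have "smap Spec_conj V s \<pp> \<in> carrier (local_at C_ring \<pp>)" if \<pp>: "\<pp> \<in> V" for \<pp>
  proof -
    obtain a f where "f \<noteq> 0" "s \<pp> = fraction C_ring (carrier C_ring - {0}) a f"
      using sections_Spec_C_fraction[OF V s \<pp>] .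
    then have "smap Spec_conj V s \<pp> = fraction C_ring (carrier C_ring - {0}) (cnj a) (cnj f)"
      and "cnj f \<in> carrier C_ring - {0}" "cnj a \<in> carrier C_ring"
      using smap_Spec_conj_fraction[OF V s \<pp>] by (simp_all add: type_ring_def)
    then show ?thesis
      unfolding P[OF \<pp>] localization_def by auto
  qed
  moreover have "\<exists>V'. openin (zariski C_ring (primes C_ring)) V' \<and> \<pp> \<in> V' \<and> V' \<subseteq> V \<and>
      (\<exists>(a, f)\<in>carrier C_ring \<times> carrier C_ring. \<forall>\<qq>\<in>V'. f \<notin> \<qq> \<and>
        smap Spec_conj V s \<qq> = fraction C_ring (carrier C_ring - \<qq>) a f)"
    if \<pp>: "\<pp> \<in> V" for \<pp>
  proof -
    obtain a f where af: "f \<noteq> 0" "s \<pp> = fraction C_ring (carrier C_ring - {0}) a f"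
      using sections_Spec_C_fraction[OF V s \<pp>] .
    \<comment> \<open>\<open>V\<close> has only the point zero ideal, so it serves as its own
      neighbourhood and one fraction describes the section on all of it.\<close>
    have "\<forall>\<qq>\<in>V. cnj f \<notin> \<qq> \<and>
        smap Spec_conj V s \<qq> = fraction C_ring (carrier C_ring - \<qq>) (cnj a) (cnj f)"
    proof
      fix \<qq> assume \<qq>: "\<qq> \<in> V"
      have "\<qq> = {0}" "\<pp> = {0}" using P \<pp> \<qq> by auto
      with af smap_Spec_conj_fraction[OF V s \<pp> af]
      show "cnj f \<notin> \<qq> \<and>
        smap Spec_conj V s \<qq> = fraction C_ring (carrier C_ring - \<qq>) (cnj a) (cnj f)"
        by simp
    qed
    moreover have "(cnj a, cnj f) \<in> carrier C_ring \<times> carrier C_ring"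
      by (simp add: type_ring_def)
    ultimately show ?thesis
      using V \<pp> unfolding rtop_Spec by (intro exI[of _ V]) fast
  qed
  ultimately show ?thesis
    unfolding carrier_sections_Spec frac_sections_def by (auto simp: PiE_iff)
qed

lemma well_typed_Spec_conj: "well_typed Spec_conj"
proof -
  have "pmap Spec_conj \<in> topspace (rtop (Spec C_ring)) \<rightarrow> topspace (rtop (Spec C_ring))"
    using topspace_Spec[of C_ring] pmap_Spec_conj by auto
  then show ?thesis
    by (simp add: well_typed_def pre_Spec_conj smap_Spec_conj_closed)
qed

lemma Spec_conj_Spec_conj: "Spec_conj \<circ>\<^sub>s Spec_conj = mid (Spec C_ring)"
proof (rule rs_map.equality)
  show "pmap (Spec_conj \<circ>\<^sub>s Spec_conj) = pmap (mid (Spec C_ring))"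
    using topspace_Spec[of C_ring] pmap_Spec_conj
    by (auto simp: mcomp_def compose_def mid_def fun_eq_iff subset_iff)
  have "smap Spec_conj V (smap Spec_conj V s) = s"
    if V: "openin (rtop (Spec C_ring)) V" and s: "s \<in> carrier (sections (Spec C_ring) V)" for V s
  \<comment> \<open>Sections are extensional functions on \<open>V\<close>, so comparing values
    suffices; there numerator and denominator are conjugated twice.\<close>
  proof (rule extensionalityI[of _ V])
    note cl = smap_Spec_conj_closed[OF V s]
    show "smap Spec_conj V (smap Spec_conj V s) \<in> extensional V"
      using smap_Spec_conj[OF V cl] by simp
    show "s \<in> extensional V"
      using s unfolding carrier_sections_Spec frac_sections_def by (auto simp: PiE_iff)
    fix \<pp> assume \<pp>: "\<pp> \<in> V"
    obtain a f where af: "f \<noteq> 0" "s \<pp> = fraction C_ring (carrier C_ring - {0}) a f"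
      using sections_Spec_C_fraction[OF V s \<pp>] .
    show "smap Spec_conj V (smap Spec_conj V s) \<pp> = s \<pp>"
      using smap_Spec_conj_fraction[OF V cl \<pp> _ smap_Spec_conj_fraction[OF V s \<pp> af]] af
      by simp
  qed
  then show "smap (Spec_conj \<circ>\<^sub>s Spec_conj) = smap (mid (Spec C_ring))"
    by (auto simp: mcomp_def compose_def mid_def fun_eq_iff pre_Spec_conj)
qed (simp_all add: mcomp_def mid_def)


section \<open>The automorphism group and the action of conjugation\<close>

lemma iso_mor_mcomp:
  assumes X: "ringed_space X" and "iso_mor X X f" "iso_mor X X g"
  shows "iso_mor X X (f \<circ>\<^sub>s g)"
proof -
  obtain f' g' where f: "mor X X f" "mor X X f'" "f' \<circ>\<^sub>s f = mid X" "f \<circ>\<^sub>s f' = mid X"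
    and g: "mor X X g" "mor X X g'" "g' \<circ>\<^sub>s g = mid X" "g \<circ>\<^sub>s g' = mid X"
    using assms unfolding iso_mor_def by auto
  note as = mor_mcomp_assoc[where X = X and Y = X and Z = X and W = X]
  note cl = mor_mcomp[OF X X X]
  have "(g' \<circ>\<^sub>s f') \<circ>\<^sub>s (f \<circ>\<^sub>s g) = g' \<circ>\<^sub>s ((f' \<circ>\<^sub>s f) \<circ>\<^sub>s g)"
    using f(1,2) g(1,2) by (simp add: as cl)
  moreover have "(f \<circ>\<^sub>s g) \<circ>\<^sub>s (g' \<circ>\<^sub>s f') = f \<circ>\<^sub>s ((g \<circ>\<^sub>s g') \<circ>\<^sub>s f')"
    using f(1,2) g(1,2) by (simp add: as cl)
  ultimately show ?thesis
    unfolding iso_mor_def using f g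
    by (intro conjI exI[of _ "g' \<circ>\<^sub>s f'"]) (auto simp: mid_mcomp intro: cl)
qed

lemma group_Aut:
  assumes X: "ringed_space X" and \<rho>: "mor X S \<rho>"
  shows "group (Aut X \<rho>)"
proof (rule groupI)
  have Aut_mor: "mor X X f" if "f \<in> carrier (Aut X \<rho>)" for f
    using that by (simp add: Aut_def iso_mor_def)
  show "f \<otimes>\<^bsub>Aut X \<rho>\<^esub> g \<in> carrier (Aut X \<rho>)"
    if "f \<in> carrier (Aut X \<rho>)" "g \<in> carrier (Aut X \<rho>)" for f g
    using that Aut_mor[OF that(1)] Aut_mor[OF that(2)] mor_mcomp_assoc[OF \<rho>, of X f X g]
      iso_mor_mcomp[OF X]
    by (simp add: Aut_def)
  show "\<one>\<^bsub>Aut X \<rho>\<^esub> \<in> carrier (Aut X \<rho>)"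
    using mor_mid[OF X] mid_mcomp[OF mor_mid[OF X]] mcomp_mid[OF \<rho>]
    by (auto simp: Aut_def iso_mor_def)
  show "f \<otimes>\<^bsub>Aut X \<rho>\<^esub> g \<otimes>\<^bsub>Aut X \<rho>\<^esub> h = f \<otimes>\<^bsub>Aut X \<rho>\<^esub> (g \<otimes>\<^bsub>Aut X \<rho>\<^esub> h)"
    if "f \<in> carrier (Aut X \<rho>)" "g \<in> carrier (Aut X \<rho>)" "h \<in> carrier (Aut X \<rho>)" for f g h
    using mor_mcomp_assoc[OF that[THEN Aut_mor]] by (simp add: Aut_def)
  show "\<one>\<^bsub>Aut X \<rho>\<^esub> \<otimes>\<^bsub>Aut X \<rho>\<^esub> f = f" if "f \<in> carrier (Aut X \<rho>)" for f
    using mid_mcomp[OF Aut_mor[OF that]] by (simp add: Aut_def)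
  show "\<exists>g\<in>carrier (Aut X \<rho>). g \<otimes>\<^bsub>Aut X \<rho>\<^esub> f = \<one>\<^bsub>Aut X \<rho>\<^esub>" if f: "f \<in> carrier (Aut X \<rho>)" for f
  proof -
    obtain g where g: "mor X X g" "g \<circ>\<^sub>s f = mid X" "f \<circ>\<^sub>s g = mid X"
      using f by (auto simp: Aut_def iso_mor_def)
    \<comment> \<open>The inverse of an isomorphism over the base is again over the base: insert
      \<open>f\<close> and cancel it against \<open>g\<close>.\<close>
    have "\<rho> \<circ>\<^sub>s g = (\<rho> \<circ>\<^sub>s f) \<circ>\<^sub>s g"
      using f by (simp add: Aut_def)
    also have "\<dots> = \<rho>"
      using mor_mcomp_assoc[OF \<rho> Aut_mor[OF f] g(1)] g(3) mcomp_mid[OF \<rho>] by simp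
    finally have "g \<in> carrier (Aut X \<rho>)"
      using g Aut_mor[OF f] by (auto simp: Aut_def iso_mor_def)
    then show ?thesis
      using g by (auto simp: Aut_def)
  qed
qed

text \<open>Both \<open>\<sigma> \<circ>\<^sub>s \<sigma>\<close> and the identity are compatible
  with the two projections: \<open>\<pi>\<close> absorbs \<open>\<sigma>\<close>, and passing
  \<open>\<sigma>\<close> through \<open>\<rho>\<close> twice conjugates twice.\<close>

lemma id_times_conj_involutive:
  assumes X: "scheme X" and \<rho>: "mor X (Spec C_ring) \<rho>"
    and form: "is_real_form X \<rho> Y \<eta> \<pi>" and \<sigma>: "is_id_times_conj X \<rho> \<pi> \<sigma>"
  shows "\<sigma> \<circ>\<^sub>s \<sigma> = mid X"
proof -
  have rs: "ringed_space X"
    using X by (simp add: scheme_def locally_ringed_space_def)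
  have \<pi>: "mor X Y \<pi>" and fp: "is_fibre_product \<pi> \<rho> \<eta> (Spec_map R_ring C_ring complex_of_real)"
    and \<eta>: "mor Y (Spec R_ring) \<eta>"
    using form by (auto simp: is_real_form_def)
  have s: "mor X X \<sigma>" "\<pi> \<circ>\<^sub>s \<sigma> = \<pi>" "\<rho> \<circ>\<^sub>s \<sigma> = Spec_conj \<circ>\<^sub>s \<rho>"
    using \<sigma> by (auto simp: is_id_times_conj_def)
  note wt = mor_well_typed[OF s(1)] mor_well_typed[OF \<pi>] mor_well_typed[OF \<rho>]
  note st = mor_src[OF s(1)] mor_tgt[OF s(1)] mor_src[OF \<pi>] mor_src[OF \<rho>] mor_tgt[OF \<rho>]
  have "\<pi> \<circ>\<^sub>s (\<sigma> \<circ>\<^sub>s \<sigma>) = (\<pi> \<circ>\<^sub>s \<sigma>) \<circ>\<^sub>s \<sigma>"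
    using wt st by (intro mcomp_assoc[symmetric]) simp_all
  then have p: "\<pi> \<circ>\<^sub>s (\<sigma> \<circ>\<^sub>s \<sigma>) = \<pi>"
    using s by simp
  have "\<rho> \<circ>\<^sub>s (\<sigma> \<circ>\<^sub>s \<sigma>) = (\<rho> \<circ>\<^sub>s \<sigma>) \<circ>\<^sub>s \<sigma>"
    using wt st by (intro mcomp_assoc[symmetric]) simp_all
  also have "\<dots> = (Spec_conj \<circ>\<^sub>s \<rho>) \<circ>\<^sub>s \<sigma>"
    by (simp only: s(3))
  also have "\<dots> = Spec_conj \<circ>\<^sub>s (\<rho> \<circ>\<^sub>s \<sigma>)"
    using wt st well_typed_Spec_conj by (intro mcomp_assoc) simp_all
  also have "\<dots> = (Spec_conj \<circ>\<^sub>s Spec_conj) \<circ>\<^sub>s \<rho>"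
    unfolding s(3) using wt st well_typed_Spec_conj by (intro mcomp_assoc[symmetric]) simp_all
  also have "\<dots> = \<rho>"
    using \<rho> by (simp add: Spec_conj_Spec_conj mid_mcomp)
  finally have r: "\<rho> \<circ>\<^sub>s (\<sigma> \<circ>\<^sub>s \<sigma>) = \<rho>" .
  have src: "src (Spec_map R_ring C_ring complex_of_real) = Spec C_ring"
    by (simp add: Spec_map_def to_Spec_def Spec_def)
  \<comment> \<open>The universal property with \<open>X\<close> itself as test scheme and its own
    projections as test maps.\<close>
  have "\<exists>!w. mor X X w \<and> \<pi> \<circ>\<^sub>s w = \<pi> \<and> \<rho> \<circ>\<^sub>s w = \<rho>"
    using fp X \<pi> \<rho> unfolding is_fibre_product_def src mor_src[OF \<pi>] mor_src[OF \<eta>] by blast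
  moreover have "mor X X (\<sigma> \<circ>\<^sub>s \<sigma>)"
    using s(1) by (intro mor_mcomp[OF rs rs rs])
  moreover note p r mor_mid[OF rs] mcomp_mid[OF \<pi>] mcomp_mid[OF \<rho>]
  ultimately show ?thesis
    by blast
qed

text \<open>\<open>\<sigma>\<close> need not lie in \<open>Aut X \<rho>\<close>, so the computation
  is done with morphisms: in a product of two conjugates the inner
  \<open>\<sigma> \<circ>\<^sub>s \<sigma>\<close> cancels.\<close>

lemma involuted_group_conj_act:
  assumes X: "ringed_space X" and \<rho>: "mor X S \<rho>"
    and \<sigma>: "mor X X \<sigma>" "\<sigma> \<circ>\<^sub>s \<sigma> = mid X"
    and H: "subgroup H (Aut X \<rho>)" "G_stable \<sigma> H"
  shows "involuted_group (Aut X \<rho>\<lparr>carrier := H\<rparr>) (conj_act \<sigma>)"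
proof -
  have H_mor: "mor X X f" if "f \<in> H" for f
    using subgroup.mem_carrier[OF H(1) that] by (simp add: Aut_def iso_mor_def)
  note as = mor_mcomp_assoc[where X = X and Y = X and Z = X and W = X]
  note cl = mor_mcomp[OF X X X]
  have \<sigma>\<sigma>: "\<sigma> \<circ>\<^sub>s (\<sigma> \<circ>\<^sub>s f) = f" if "mor X X f" for f
    using as[OF \<sigma>(1) \<sigma>(1) that] \<sigma>(2) that by (simp add: mid_mcomp)
  have closed: "conj_act \<sigma> f \<in> H" if "f \<in> H" for f
    using H(2) that by (simp add: G_stable_def)
  interpret K: group "Aut X \<rho>\<lparr>carrier := H\<rparr>"
    using subgroup.subgroup_is_group[OF H(1) group_Aut[OF X \<rho>]] .
  show ?thesis
  proof
    show "conj_act \<sigma> \<in> hom (Aut X \<rho>\<lparr>carrier := H\<rparr>) (Aut X \<rho>\<lparr>carrier := H\<rparr>)"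
      using closed \<sigma>(1)
      by (auto simp: hom_def Aut_def conj_act_def as cl H_mor \<sigma>\<sigma>)
    fix f assume "f \<in> carrier (Aut X \<rho>\<lparr>carrier := H\<rparr>)"
    then have f: "mor X X f"
      by (simp add: H_mor)
    then show "conj_act \<sigma> (conj_act \<sigma> f) = f"
      using \<sigma> by (simp add: conj_act_def as cl \<sigma>\<sigma> mcomp_mid)
  qed
qed

section \<open>The count for the variety\<close>

theorem theorem3p2:
  fixes X Y\<^sub>0 :: "('p, 's) rspace"
    and \<rho> :: "('p, 's) cscheme_structure"
    and \<eta> :: "('p, 's) rscheme_structure"
    and \<pi> \<sigma>\<^sub>0 :: "('p, 's, 'p, 's) rs_map"
    and H :: "('p, 's, 'p, 's) rs_map set"
    and rep :: "('p, 's, 'p, 's) rs_map set \<Rightarrow> ('p, 's, 'p, 's) rs_map"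
  assumes "quasi_projective_variety X \<rho>"
    and "is_real_form X \<rho> Y\<^sub>0 \<eta> \<pi>"
    and "is_id_times_conj X \<rho> \<pi> \<sigma>\<^sub>0"
    and "finite (carrier (Aut X \<rho>))"
    and "sylow_subgroup 2 H (Aut X \<rho>)"
    and "G_stable \<sigma>\<^sub>0 H"
    and "\<And>\<xi>. \<xi> \<in> H1 X \<rho> \<sigma>\<^sub>0 H \<Longrightarrow> rep \<xi> \<in> \<xi>"
  shows "(\<Sum>\<xi>\<in>H1 X \<rho> \<sigma>\<^sub>0 H. 1 / real (card (Aut_real_form X \<rho> (rep \<xi> \<circ>\<^sub>s \<sigma>\<^sub>0) \<inter> H)))
           = real (card (Z1 X \<sigma>\<^sub>0 H)) / real (card H)
         \<and> real (card (Z1 X \<sigma>\<^sub>0 H)) / real (card H) \<le> 1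
         \<and> (\<not> comm_group ((Aut X \<rho>)\<lparr>carrier := H\<rparr>) \<longrightarrow>
              real (card (Z1 X \<sigma>\<^sub>0 H)) / real (card H) < 1)"
proof -
  let ?K = "Aut X \<rho>\<lparr>carrier := H\<rparr>"
  have sch: "scheme X" and \<rho>: "mor X (Spec C_ring) \<rho>"
    using assms(1) by (simp_all add: quasi_projective_variety_def integral_scheme_def)
  then have X: "ringed_space X"
    by (simp add: scheme_def locally_ringed_space_def)
  have H: "subgroup H (Aut X \<rho>)"
    using assms(5) by (simp add: sylow_subgroup_def)
  have fin: "finite H"
    using assms(4) subgroup.subset[OF H] by (rule finite_subset[rotated])
  have \<sigma>: "mor X X \<sigma>\<^sub>0" "\<sigma>\<^sub>0 \<circ>\<^sub>s \<sigma>\<^sub>0 = mid X"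
    using assms(3) id_times_conj_involutive[OF sch \<rho> assms(2,3)]
    by (simp_all add: is_id_times_conj_def)
  interpret A: group "Aut X \<rho>"
    using group_Aut[OF X \<rho>] .
  interpret K: involuted_group ?K "conj_act \<sigma>\<^sub>0"
    using involuted_group_conj_act[OF X \<rho> \<sigma> H assms(6)] .
  have mult: "f \<otimes>\<^bsub>Aut X \<rho>\<^esub> g = f \<circ>\<^sub>s g" and one: "\<one>\<^bsub>Aut X \<rho>\<^esub> = mid X" for f g
    by (simp_all add: Aut_def)
  have Z1: "Z1 X \<sigma>\<^sub>0 H = K.cocycles"
    by (simp add: Z1_def K.cocycles_def mult one)
  \<comment> \<open>\<open>cohomologous\<close> inverts in the full automorphism group, the locale
    in \<open>H\<close>; for a subgroup the two inverses agree.\<close>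
  have tw: "K.twist f h = inv\<^bsub>Aut X \<rho>\<^esub> h \<circ>\<^sub>s f \<circ>\<^sub>s conj_act \<sigma>\<^sub>0 h" if "h \<in> H" for f h
    using A.m_inv_consistent[OF H that] by (simp add: K.twist_def mult)
  then have H1: "H1 X \<rho> \<sigma>\<^sub>0 H = K.cocycles // K.cocycle_rel"
    by (simp add: H1_def Z1 cohomologous_def K.cocycle_rel_def)
  have centralizer: "Aut_real_form X \<rho> (f \<circ>\<^sub>s \<sigma>\<^sub>0) \<inter> H = K.twisted_centralizer f"
    if f: "f \<in> H" for f
  proof -
    have H_mor: "mor X X f" if "f \<in> H" for f
      using subgroup.mem_carrier[OF H that] by (simp add: Aut_def iso_mor_def)
    note as = mor_mcomp_assoc[where X = X and Y = X and Z = X and W = X]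
    note cl = mor_mcomp[OF X X X]
    \<comment> \<open>Composition with the involution \<open>\<sigma>\<^sub>0\<close> on the right
      passes between the two equations.\<close>
    have "h \<circ>\<^sub>s (f \<circ>\<^sub>s \<sigma>\<^sub>0) = (f \<circ>\<^sub>s \<sigma>\<^sub>0) \<circ>\<^sub>s h \<longleftrightarrow> h \<circ>\<^sub>s f = f \<circ>\<^sub>s conj_act \<sigma>\<^sub>0 h"
      (is "?L \<longleftrightarrow> ?R") if h: "h \<in> H" for h
    proof
      assume ?L
      then have "(h \<circ>\<^sub>s (f \<circ>\<^sub>s \<sigma>\<^sub>0)) \<circ>\<^sub>s \<sigma>\<^sub>0 = ((f \<circ>\<^sub>s \<sigma>\<^sub>0) \<circ>\<^sub>s h) \<circ>\<^sub>s \<sigma>\<^sub>0"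
        by simp
      then show ?R
        using H_mor[OF f] H_mor[OF h] \<sigma> by (simp add: as cl conj_act_def mcomp_mid)
    next
      assume ?R
      then have "(h \<circ>\<^sub>s f) \<circ>\<^sub>s \<sigma>\<^sub>0 = (f \<circ>\<^sub>s conj_act \<sigma>\<^sub>0 h) \<circ>\<^sub>s \<sigma>\<^sub>0"
        by simp
      then show ?L
        using H_mor[OF f] H_mor[OF h] \<sigma> by (simp add: as cl conj_act_def mcomp_mid)
    qed
    then show ?thesis
      using subgroup.mem_carrier[OF H]
      by (auto simp: Aut_real_form_def K.twisted_centralizer_def mult)
  qed
  have rep: "rep \<xi> \<in> \<xi>" if "\<xi> \<in> K.cocycles // K.cocycle_rel" for \<xi>
    using assms(7) that by (simp add: H1)
  have rep_H: "rep \<xi> \<in> H" if "\<xi> \<in> K.cocycles // K.cocycle_rel" for \<xi>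
    using rep[OF that] in_quotient_imp_subset[OF K.equiv_cocycle_rel that]
    by (auto simp: K.cocycles_def)
  have mass: "(\<Sum>\<xi>\<in>H1 X \<rho> \<sigma>\<^sub>0 H. 1 / real (card (Aut_real_form X \<rho> (rep \<xi> \<circ>\<^sub>s \<sigma>\<^sub>0) \<inter> H)))
      = real (card (Z1 X \<sigma>\<^sub>0 H)) / real (card H)"
    using K.mass_formula[OF _ rep] fin rep_H by (simp add: H1 Z1 centralizer)
  have sub: "K.cocycles \<subseteq> H"
    by (auto simp: K.cocycles_def)
  have pos: "card H > 0"
    using fin subgroup.one_closed[OF H] by (auto simp: card_gt_0_iff)
  \<comment> \<open>Since \<open>H\<close> is finite, equal cardinalities make every element of
    \<open>H\<close> a cocycle; the contrapositive gives strictness.\<close>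
  have "comm_group ?K" if "card K.cocycles = card H"
    using K.comm_group_if_all_cocycles card_subset_eq[OF fin sub that] by simp
  then show ?thesis
    using mass pos card_mono[OF fin sub] by (auto simp: Z1 le_less)
qed

end
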